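(* Let $\Bbbk$ be a field and $R=\Bbbk[[t]]$. Let $\mathscr B$ be the category of finitely generated $R$-modules and $\mathscr A$ the category of $R$-modules of finite length. Then $\mathscr B$ has exactly one simple object up to isomorphism, namely $\Bbbk=R/(t)$, but $[\Bbbk]$ does not generate $K_0(\mathscr B)$. Moreover, $\mathscr A$ is a Serre subcategory of $\mathscr B$, while the homomorphism $K_0(\mathscr A)\to K_0(\mathscr B)$ induced by the inclusion is not injective.
   Context: For an (essentially small) abelian category $\mathscr A$, $K_0(\mathscr A)$ is the ordinary Grothendieck group: generated by isomorphism classes $[M]$ with relations $[M]=[M']+[M'']$ for short exact sequences $0\to M'\to M\to M''\to0$. A Serre subcategory is a full subcategory closed under subobjects, quotients and extensions. *)

theory Defs
  imports
    "HOL-Algebra.Algebra"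
    "HOL-Algebra.Algebraic_Closure_Type"
    "HOL-Computational_Algebra.Formal_Power_Series"
    "HOL-Library.Extended_Nat"
begin

text \<open>
  A module over a ring record \<open>R\<close> is a record \<open>M :: ('r, 'm) module\<close> satisfying
  \<^locale>\<open>module\<close>; its ring fields \<open>mult\<close> and \<open>one\<close> carry no meaning.
  A full subcategory of the category of \<open>R\<close>-modules is given by its set of objects, a set of
  modules whose carriers lie in one fixed type \<open>'m\<close>, which plays the role of the universe.
\<close>

definition module_hom ::
  "('r, 'x) ring_scheme \<Rightarrow> ('r, 'm, 'y) module_scheme \<Rightarrow> ('r, 'n, 'z) module_scheme \<Rightarrow> ('m \<Rightarrow> 'n) set"
where
  "module_hom R M N = {f \<in> carrier M \<rightarrow> carrier N.
     (\<forall>x\<in>carrier M. \<forall>y\<in>carrier M. f (x \<oplus>\<^bsub>M\<^esub> y) = f x \<oplus>\<^bsub>N\<^esub> f y) \<and>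
     (\<forall>r\<in>carrier R. \<forall>x\<in>carrier M. f (r \<odot>\<^bsub>M\<^esub> x) = r \<odot>\<^bsub>N\<^esub> f x)}"

definition module_iso ::
  "('r, 'x) ring_scheme \<Rightarrow> ('r, 'm, 'y) module_scheme \<Rightarrow> ('r, 'n, 'z) module_scheme \<Rightarrow> bool"
where
  "module_iso R M N \<longleftrightarrow> (\<exists>f\<in>module_hom R M N. bij_betw f (carrier M) (carrier N))"

definition short_exact ::
  "('r, 'x) ring_scheme \<Rightarrow> ('r, 'l) module \<Rightarrow> ('l \<Rightarrow> 'm) \<Rightarrow> ('r, 'm) module \<Rightarrow> ('m \<Rightarrow> 'n) \<Rightarrow> ('r, 'n) module \<Rightarrow> bool"
where
  "short_exact R M' f M g M'' \<longleftrightarrow>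
     f \<in> module_hom R M' M \<and> g \<in> module_hom R M M'' \<and>
     inj_on f (carrier M') \<and>
     f ` carrier M' = {x \<in> carrier M. g x = \<zero>\<^bsub>M''\<^esub>} \<and>
     g ` carrier M = carrier M''"

definition finitely_generated :: "('r, 'x) ring_scheme \<Rightarrow> ('r, 'm) module \<Rightarrow> bool" where
  "finitely_generated R M \<longleftrightarrow> (\<exists>S. finite S \<and> S \<subseteq> carrier M \<and>
     (\<forall>x\<in>carrier M. \<exists>c \<in> S \<rightarrow> carrier R. x = (\<Oplus>\<^bsub>M\<^esub>s\<in>S. c s \<odot>\<^bsub>M\<^esub> s)))"

text \<open>
  The length is the supremum of all \<open>n\<close> for which there is a chain
  \<open>M\<^sub>0 \<subset> M\<^sub>1 \<subset> \<dots> \<subset> M\<^sub>n\<close> of submodules; such a chain is a list of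
  \<open>n + 1\<close> submodules.
\<close>

definition module_length :: "('r, 'x) ring_scheme \<Rightarrow> ('r, 'm) module \<Rightarrow> enat" where
  "module_length R M =
     (SUP Ms \<in> {Ms. sorted_wrt (\<subset>) Ms \<and> (\<forall>N\<in>set Ms. submodule N R M)}. enat (length Ms - 1))"

definition fg_modules :: "('r, 'x) ring_scheme \<Rightarrow> ('r, 'm) module set" where
  "fg_modules R = {M. module R M \<and> finitely_generated R M}"

definition finite_length_modules :: "('r, 'x) ring_scheme \<Rightarrow> ('r, 'm) module set" where
  "finite_length_modules R = {M. module R M \<and> module_length R M < \<infinity>}"

text \<open>
  Subobjects in a full subcategory \<open>C\<close> are represented by injective homomorphisms and
  quotient objects by surjective ones, in each case between objects of \<open>C\<close>.
\<close>

definition simple_object :: "('r, 'x) ring_scheme \<Rightarrow> ('r, 'm) module set \<Rightarrow> ('r, 'm) module \<Rightarrow> bool" where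
  "simple_object R C S \<longleftrightarrow> S \<in> C \<and> carrier S \<noteq> {\<zero>\<^bsub>S\<^esub>} \<and>
     (\<forall>N\<in>C. \<forall>f\<in>module_hom R N S. inj_on f (carrier N) \<longrightarrow>
        f ` carrier N = {\<zero>\<^bsub>S\<^esub>} \<or> f ` carrier N = carrier S)"

definition serre_subcategory :: "('r, 'x) ring_scheme \<Rightarrow> ('r, 'm) module set \<Rightarrow> ('r, 'm) module set \<Rightarrow> bool" where
  "serre_subcategory R A B \<longleftrightarrow> A \<noteq> {} \<and> A \<subseteq> B \<and>
     (\<forall>M\<in>A. \<forall>N\<in>B. \<forall>f\<in>module_hom R N M. inj_on f (carrier N) \<longrightarrow> N \<in> A) \<and>
     (\<forall>M\<in>A. \<forall>N\<in>B. \<forall>g\<in>module_hom R M N. g ` carrier M = carrier N \<longrightarrow> N \<in> A) \<and>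
     (\<forall>M'\<in>A. \<forall>M\<in>B. \<forall>M''\<in>A. \<forall>f g. short_exact R M' f M g M'' \<longrightarrow> M \<in> A)"

text \<open>
  The argument of \<open>iso_class\<close> need not live in the universe \<open>'m\<close>, so that for instance the
  class of a module of cosets makes sense.
\<close>

definition iso_class :: "('r, 'x) ring_scheme \<Rightarrow> ('r, 'n) module \<Rightarrow> ('r, 'm) module set" where
  "iso_class R M = {N. module R N \<and> module_iso R M N}"

definition K0_free :: "('r, 'x) ring_scheme \<Rightarrow> ('r, 'm) module set \<Rightarrow> (('r, 'm) module set \<Rightarrow>\<^sub>0 int) monoid" where
  "K0_free R C = free_Abelian_group (iso_class R ` C)"

definition K0_relations :: "('r, 'x) ring_scheme \<Rightarrow> ('r, 'm) module set \<Rightarrow> (('r, 'm) module set \<Rightarrow>\<^sub>0 int) set" where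
  "K0_relations R C = generate (K0_free R C)
     {frag_of (iso_class R M) - (frag_of (iso_class R M') + frag_of (iso_class R M'')) | M' f M g M''.
        M' \<in> C \<and> M \<in> C \<and> M'' \<in> C \<and> short_exact R M' f M g M''}"

definition K0 :: "('r, 'x) ring_scheme \<Rightarrow> ('r, 'm) module set \<Rightarrow> (('r, 'm) module set \<Rightarrow>\<^sub>0 int) set monoid" where
  "K0 R C = K0_free R C Mod K0_relations R C"

definition K0_class ::
  "('r, 'x) ring_scheme \<Rightarrow> ('r, 'm) module set \<Rightarrow> ('r, 'n) module \<Rightarrow> (('r, 'm) module set \<Rightarrow>\<^sub>0 int) set"
where
  "K0_class R C M = K0_relations R C #>\<^bsub>K0_free R C\<^esub> frag_of (iso_class R M)"

text \<open>
  For \<open>A \<subseteq> B\<close> the generators and relations for \<open>A\<close> are among those for \<open>B\<close>; a coset of the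
  relations for \<open>A\<close> is sent to the coset of the relations for \<open>B\<close> that contains it.
\<close>

definition K0_incl ::
  "('r, 'x) ring_scheme \<Rightarrow> ('r, 'm) module set \<Rightarrow> (('r, 'm) module set \<Rightarrow>\<^sub>0 int) set \<Rightarrow> (('r, 'm) module set \<Rightarrow>\<^sub>0 int) set"
where
  "K0_incl R B \<xi> = K0_relations R B <#>\<^bsub>K0_free R B\<^esub> \<xi>"

definition quotient_module :: "('r, 'x) ring_scheme \<Rightarrow> 'r set \<Rightarrow> ('r, 'r set) module" where
  "quotient_module R I =
     \<lparr>carrier = carrier (R Quot I), monoid.mult = monoid.mult (R Quot I), one = \<one>\<^bsub>R Quot I\<^esub>,
      ring.zero = \<zero>\<^bsub>R Quot I\<^esub>, add = add (R Quot I),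
      module.smult = (\<lambda>r a. (I +>\<^bsub>R\<^esub> r) \<otimes>\<^bsub>R Quot I\<^esub> a)\<rparr>"

abbreviation fps_ring :: "'a::field fps ring" where
  "fps_ring \<equiv> ring_of_type_algebra"


lemma comm_group_K0: "comm_group (K0 R C)"
proof -
  interpret F: comm_group "K0_free R C"
    unfolding K0_free_def by (rule abelian_free_Abelian_group)
  have "subgroup (K0_relations R C) (K0_free R C)"
    unfolding K0_relations_def
    by (rule F.generate_is_subgroup)
       (auto simp: K0_free_def dest!: subsetD [OF keys_diff] subsetD [OF keys_add] split: if_splits)
  then show ?thesis
    unfolding K0_def by (rule F.abelian_FactGroup)
qed

text \<open>
  Transport of structure, and the fact that every type into which \<open>k[[t]]\<close> embeds is a large
  enough universe: it contains a copy of each finitely generated module, whatever the type of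
  the carrier of the latter.
\<close>

lemma module_transport:
  fixes N :: "('r, 'n) module" and h :: "'n \<Rightarrow> 'm"
  assumes N: "module R N" and h: "inj_on h (carrier N)"
  obtains M :: "('r, 'm) module"
  where "module R M" "carrier M = h ` carrier N" "h \<in> module_hom R N M" "module_iso R N M"
proof -
  interpret N: module R N by (rule N)
  define i where "i = inv_into (carrier N) h"
  have i[simp]: "i (h x) = x" if "x \<in> carrier N" for x
    using h that by (simp add: i_def)
  define M :: "('r, 'm) module" where
    "M = \<lparr>carrier = h ` carrier N, monoid.mult = undefined, one = undefined, ring.zero = h \<zero>\<^bsub>N\<^esub>,
          add = (\<lambda>x y. h (i x \<oplus>\<^bsub>N\<^esub> i y)), module.smult = (\<lambda>r x. h (r \<odot>\<^bsub>N\<^esub> i x))\<rparr>"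
  have ab: "abelian_group M"
  proof (rule abelian_groupI)
    fix x assume "x \<in> carrier M"
    then obtain a where "a \<in> carrier N" "x = h a" by (auto simp: M_def)
    then show "\<exists>y\<in>carrier M. y \<oplus>\<^bsub>M\<^esub> x = \<zero>\<^bsub>M\<^esub>"
      by (intro bexI[of _ "h (\<ominus>\<^bsub>N\<^esub> a)"]) (auto simp: M_def N.l_neg)
  qed (auto simp: M_def N.a_ac)
  have "module R M"
    by (rule moduleI[OF N.R.is_cring ab])
       (auto simp: M_def N.smult_l_distr N.smult_r_distr N.smult_assoc1)
  moreover have hom: "h \<in> module_hom R N M"
    by (auto simp: module_hom_def M_def)
  moreover have "module_iso R N M"
    unfolding module_iso_def using hom h by (intro bexI[of _ h]) (auto simp: bij_betw_def M_def)
  ultimately show ?thesis using that by (simp add: M_def)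
qed

lemma fg_module_iso_in_universe:
  fixes N :: "('a::field fps, 'n) module" and emb :: "'a fps \<Rightarrow> 'm"
  assumes emb: "inj emb" and N: "module fps_ring N" and fg: "finitely_generated fps_ring N"
  shows "\<exists>M :: ('a fps, 'm) module. module fps_ring M \<and> module_iso fps_ring N M"
proof -
  obtain S where S: "finite S" "S \<subseteq> carrier N"
    and ex: "\<forall>x\<in>carrier N. \<exists>c \<in> S \<rightarrow> carrier fps_ring. x = (\<Oplus>\<^bsub>N\<^esub>s\<in>S. c s \<odot>\<^bsub>N\<^esub> s)"
    using fg unfolding finitely_generated_def by blast
  interpret N: module fps_ring N by (rule N)
  from ex obtain c where c: "\<And>x. x \<in> carrier N \<Longrightarrow> x = (\<Oplus>\<^bsub>N\<^esub>s\<in>S. c x s \<odot>\<^bsub>N\<^esub> s)"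
    by metis
  obtain e :: "'n \<Rightarrow> nat" where e: "inj_on e S"
    using finite_imp_inj_to_nat_seg[OF S(1)] by blast
  define code where "code x = Abs_fps (\<lambda>m. fps_nth (c x (inv_into S e (fst (prod_decode m)))) (snd (prod_decode m)))" for x
  have same: "c x s = c y s" if "code x = code y" "s \<in> S" for x y s
  proof (rule fps_ext)
    fix j
    have "fps_nth (code x) (prod_encode (e s, j)) = fps_nth (code y) (prod_encode (e s, j))"
      using that(1) by simp
    then show "fps_nth (c x s) j = fps_nth (c y s) j"
      using e that(2) by (simp add: code_def)
  qed
  have "inj_on code (carrier N)"
  proof (rule inj_onI)
    fix x y assume xy: "x \<in> carrier N" "y \<in> carrier N" "code x = code y"
    have "(\<Oplus>\<^bsub>N\<^esub>s\<in>S. c x s \<odot>\<^bsub>N\<^esub> s) = (\<Oplus>\<^bsub>N\<^esub>s\<in>S. c y s \<odot>\<^bsub>N\<^esub> s)"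
      using S(2) same[OF xy(3)]
      by (intro N.M.finsum_cong') (auto simp: ring_of_type_algebra_def intro!: N.smult_closed)
    then show "x = y" using c xy(1,2) by metis
  qed
  then have "inj_on (emb \<circ> code) (carrier N)"
    using emb by (simp add: comp_inj_on_iff inj_on_def)
  from module_transport[OF N this] show ?thesis by metis
qed

end

theory Submission
  imports Defs
begin

text \<open>
  Call a submodule \<open>N\<close> of \<open>M\<close> closed with respect to a multiplicative set \<open>T\<close> if \<open>r x \<in> N\<close> with
  \<open>r \<in> T\<close> implies \<open>x \<in> N\<close>. The maximal length of chains of closed submodules is the length for
  \<open>T = {1}\<close> and the rank for \<open>T = R - {0}\<close>, and it is additive on short exact sequences for every
  \<open>T\<close>. The rank is finite on finitely generated modules, so it shows \<open>[R] \<noteq> 0\<close> in \<open>K\<^sub>0(B)\<close>;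
  the length shows \<open>[k] \<noteq> 0\<close> in \<open>K\<^sub>0(A)\<close>. On the other hand \<open>[k] = 0\<close> in \<open>K\<^sub>0(B)\<close> because of
  the exact sequence \<open>0 \<rightarrow> R \<rightarrow> R \<rightarrow> k \<rightarrow> 0\<close> given by multiplication by \<open>t\<close>.
\<close>

section \<open>Lengths of chains of sets\<close>

text \<open>If \<open>T\<close> is a submonoid of the ring, the closed submodules of M correspond to
  the submodules of the localization of M at T. The invariant is thus the length of that
  localization, and its additivity combines exactness of localization with additivity of length.
  Staying with closed submodules of M itself replaces the construction of fractions and dimension
  theory over the fraction field. Additivity splits into two inequalities. Subadditivity holds for
  all values in \<open>enat\<close> and yields closure under extensions; the reverse inequality
  concatenates longest chains, so it is proved where the values are finite. Once [k] vanishes in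
  K_0(B), the subgroup that it generates is trivial. A single nonzero class, here [R], therefore
  refutes generation, and a nonzero [k] in K_0(A) refutes injectivity. All objects have carriers in
  one type, where R and k themselves need not live. Isomorphic copies take their place, which is why
  k is handled through a surjection from R with prescribed kernel.\<close>

definition chain_length :: "'a set set \<Rightarrow> enat" where
  "chain_length F = (SUP Ms\<in>{Ms. sorted_wrt (\<subset>) Ms \<and> set Ms \<subseteq> F}. enat (length Ms - 1))"

lemma chain_length_ge:
  "sorted_wrt (\<subset>) Ms \<Longrightarrow> set Ms \<subseteq> F \<Longrightarrow> enat (length Ms - 1) \<le> chain_length F"
  unfolding chain_length_def by (rule SUP_upper) simp

lemma chain_length_leI:
  assumes "\<And>Ms. sorted_wrt (\<subset>) Ms \<Longrightarrow> set Ms \<subseteq> F \<Longrightarrow> Ms \<noteq> [] \<Longrightarrow> enat (length Ms - 1) \<le> b"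
  shows "chain_length F \<le> b"
  unfolding chain_length_def
proof (rule SUP_least)
  fix Ms assume "Ms \<in> {Ms. sorted_wrt (\<subset>) Ms \<and> set Ms \<subseteq> F}"
  then show "enat (length Ms - 1) \<le> b"
    using assms[of Ms] by (cases "Ms = []") (auto simp: zero_enat_def[symmetric])
qed

text \<open>A finite supremum in \<open>enat\<close> of a nonempty set is a maximum. If it is
  attained by the empty list, then truncated subtraction makes it 0, and a chain \<open>[U]\<close>
  with one entry has the required length.\<close>

lemma chain_length_attained:
  assumes "chain_length F = enat n" "F \<noteq> {}"
  obtains Ms where "sorted_wrt (\<subset>) Ms" "set Ms \<subseteq> F" "length Ms = Suc n"
proof -
  define V where "V = (\<lambda>Ms. enat (length Ms - 1)) ` {Ms. sorted_wrt (\<subset>) Ms \<and> set Ms \<subseteq> F}"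
  have "enat (length ([] :: 'a set list) - 1) \<in> V" unfolding V_def by (rule imageI) simp
  then have ne: "V \<noteq> {}" by blast
  have Sup: "Sup V = enat n" using assms(1) unfolding chain_length_def V_def by simp
  then have "finite V" using ne by (auto simp: Sup_enat_def split: if_splits)
  then have "enat n \<in> V" using Sup ne Max_in[of V] by (simp add: Sup_enat_def)
  then obtain Ms where Ms: "sorted_wrt (\<subset>) Ms" "set Ms \<subseteq> F" "n = length Ms - 1"
    unfolding V_def by auto
  obtain U where U: "U \<in> F" using assms(2) by blast
  show thesis
  proof (cases "Ms = []")
    case True
    then show ?thesis using that[of "[U]"] U Ms(3) by simp
  next
    case False
    then show ?thesis using that[OF Ms(1,2)] Ms(3) by (cases Ms) auto
  qed
qed

lemma sorted_wrt_map_strict: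
  assumes "sorted_wrt (\<subset>) Ms" "set Ms \<subseteq> F"
    and "\<And>U W. U \<in> F \<Longrightarrow> W \<in> F \<Longrightarrow> U \<subset> W \<Longrightarrow> f U \<subset> f W"
  shows "sorted_wrt (\<subset>) (map f Ms)"
  unfolding sorted_wrt_map
proof (rule sorted_wrt_mono_rel[OF _ assms(1)])
  fix U W assume "U \<in> set Ms" "W \<in> set Ms" "U \<subset> W"
  then show "f U \<subset> f W" using assms(2) by (intro assms(3)) blast+
qed

lemma chain_length_mono:
  assumes in1: "\<And>U. U \<in> F \<Longrightarrow> \<alpha> U \<in> G"
    and strict: "\<And>U W. U \<in> F \<Longrightarrow> W \<in> F \<Longrightarrow> U \<subset> W \<Longrightarrow> \<alpha> U \<subset> \<alpha> W"
  shows "chain_length F \<le> chain_length G"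
proof (rule chain_length_leI)
  fix Ms assume Ms: "sorted_wrt (\<subset>) Ms" "set Ms \<subseteq> F"
  have "sorted_wrt (\<subset>) (map \<alpha> Ms)"
    by (rule sorted_wrt_map_strict[OF Ms strict])
  moreover have "set (map \<alpha> Ms) \<subseteq> G" using in1 Ms(2) by auto
  ultimately show "enat (length Ms - 1) \<le> chain_length G"
    using chain_length_ge[of "map \<alpha> Ms" G] by simp
qed

text \<open>Each step of a chain in \<open>F\<close> is strict for \<alpha> or for \<beta>. Deleting
  repetitions from the two sequences of images therefore leaves two chains that together have at
  least as many steps as the given one.\<close>

lemma chain_length_subadd:
  assumes in1: "\<And>U. U \<in> F \<Longrightarrow> \<alpha> U \<in> G" and in2: "\<And>U. U \<in> F \<Longrightarrow> \<beta> U \<in> H"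
    and mono1: "\<And>U W. U \<in> F \<Longrightarrow> W \<in> F \<Longrightarrow> U \<subset> W \<Longrightarrow> \<alpha> U \<subseteq> \<alpha> W"
    and mono2: "\<And>U W. U \<in> F \<Longrightarrow> W \<in> F \<Longrightarrow> U \<subset> W \<Longrightarrow> \<beta> U \<subseteq> \<beta> W"
    and strict: "\<And>U W. U \<in> F \<Longrightarrow> W \<in> F \<Longrightarrow> U \<subset> W \<Longrightarrow> \<alpha> U \<noteq> \<alpha> W \<or> \<beta> U \<noteq> \<beta> W"
  shows "chain_length F \<le> chain_length G + chain_length H"
proof (rule chain_length_leI)
  fix Ms assume "sorted_wrt (\<subset>) Ms" "set Ms \<subseteq> F" "Ms \<noteq> []"
  \<comment> \<open>The heads are recorded because a new first set has to be compared only with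
    them; transitivity does the rest. The \<open>+ 1\<close> compares entries with steps: each list
    has one entry more than steps, and there are two lists against one.\<close>
  then have "\<exists>As Bs. As \<noteq> [] \<and> Bs \<noteq> [] \<and> hd As = \<alpha> (hd Ms) \<and> hd Bs = \<beta> (hd Ms) \<and>
    sorted_wrt (\<subset>) As \<and> sorted_wrt (\<subset>) Bs \<and> set As \<subseteq> G \<and> set Bs \<subseteq> H \<and>
    length Ms + 1 \<le> length As + length Bs"
  proof (induction Ms)
    case (Cons U Ms)
    show ?case
    proof (cases "Ms = []")
      case True
      then show ?thesis using Cons.prems in1 in2
        by (intro exI[of _ "[\<alpha> U]"] exI[of _ "[\<beta> U]"]) simp
    next
      case False
      with Cons obtain As Bs where AB: "As \<noteq> []" "Bs \<noteq> []" "hd As = \<alpha> (hd Ms)" "hd Bs = \<beta> (hd Ms)"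
        "sorted_wrt (\<subset>) As" "sorted_wrt (\<subset>) Bs" "set As \<subseteq> G" "set Bs \<subseteq> H"
        "length Ms + 1 \<le> length As + length Bs" by auto
      have U: "U \<in> F" "hd Ms \<in> F" "U \<subset> hd Ms" using Cons.prems False by (auto simp: hd_in_set subset_iff)
      define As' where "As' = (if \<alpha> U = hd As then As else \<alpha> U # As)"
      define Bs' where "Bs' = (if \<beta> U = hd Bs then Bs else \<beta> U # Bs)"
      have ext: "sorted_wrt (\<subset>) (Z # Zs)" if "Zs \<noteq> []" "sorted_wrt (\<subset>) Zs" "Z \<subset> hd Zs"
        for Z and Zs :: "'z set list"
        using that by (cases Zs) auto
      have "sorted_wrt (\<subset>) As'" "sorted_wrt (\<subset>) Bs'"
        using ext[OF AB(1,5), of "\<alpha> U"] ext[OF AB(2,6), of "\<beta> U"] AB mono1[OF U] mono2[OF U]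
        by (auto simp: As'_def Bs'_def simp del: sorted_wrt.simps)
      moreover have "hd As' = \<alpha> U" "hd Bs' = \<beta> U" "As' \<noteq> []" "Bs' \<noteq> []"
        "set As' \<subseteq> G" "set Bs' \<subseteq> H"
        using AB U in1 in2 by (auto simp: As'_def Bs'_def)
      moreover have "length (U # Ms) + 1 \<le> length As' + length Bs'"
        using strict[OF U] AB(3,4,9) by (auto simp: As'_def Bs'_def)
      ultimately show ?thesis by (intro exI[of _ As'] exI[of _ Bs']) simp
    qed
  qed simp
  then obtain As Bs where AB: "As \<noteq> []" "Bs \<noteq> []"
    "sorted_wrt (\<subset>) As" "sorted_wrt (\<subset>) Bs" "set As \<subseteq> G" "set Bs \<subseteq> H"
    "length Ms + 1 \<le> length As + length Bs" by blast
  have "length Ms - 1 \<le> (length As - 1) + (length Bs - 1)"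
    using AB(1,2,7) by (cases As; cases Bs) auto
  then have "enat (length Ms - 1) \<le> enat (length As - 1) + enat (length Bs - 1)" by simp
  also have "\<dots> \<le> chain_length G + chain_length H"
    using AB by (intro add_mono chain_length_ge)
  finally show "enat (length Ms - 1) \<le> chain_length G + chain_length H" .
qed

text \<open>A longest chain in \<open>H\<close>, moved by \<open>b\<close>, is put on top of a
  longest chain in \<open>G\<close>, moved by \<open>a\<close>. Finiteness guarantees that longest
  chains exist.\<close>

lemma chain_length_superadd:
  assumes fin: "chain_length G \<noteq> \<infinity>" "chain_length H \<noteq> \<infinity>" and ne: "G \<noteq> {}" "H \<noteq> {}"
    and in1: "\<And>U. U \<in> G \<Longrightarrow> a U \<in> F" and in2: "\<And>W. W \<in> H \<Longrightarrow> b W \<in> F"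
    and strict1: "\<And>U U'. U \<in> G \<Longrightarrow> U' \<in> G \<Longrightarrow> U \<subset> U' \<Longrightarrow> a U \<subset> a U'"
    and strict2: "\<And>W W'. W \<in> H \<Longrightarrow> W' \<in> H \<Longrightarrow> W \<subset> W' \<Longrightarrow> b W \<subset> b W'"
    and below: "\<And>U W. U \<in> G \<Longrightarrow> W \<in> H \<Longrightarrow> a U \<subseteq> b W"
  shows "chain_length G + chain_length H \<le> chain_length F"
proof -
  obtain m n where mn: "chain_length G = enat m" "chain_length H = enat n" using fin by auto
  obtain As where As: "sorted_wrt (\<subset>) As" "set As \<subseteq> G" "length As = Suc m"
    using chain_length_attained mn(1) ne(1) by blast
  obtain Bs where Bs: "sorted_wrt (\<subset>) Bs" "set Bs \<subseteq> H" "length Bs = Suc n"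
    using chain_length_attained mn(2) ne(2) by blast
  obtain B Bs' where B: "Bs = B # Bs'" using Bs(3) by (cases Bs) auto
  \<comment> \<open>The lowest set \<open>b B\<close> is dropped because the last
    \<open>a\<close>-image may equal it. This leaves (m + 1) + n entries, that is m + n steps, and
    \<open>b B\<close> still separates the two parts strictly.\<close>
  define Ms where "Ms = map a As @ map b Bs'"
  have "sorted_wrt (\<subset>) (map a As)"
    by (rule sorted_wrt_map_strict[OF As(1,2) strict1])
  moreover have "sorted_wrt (\<subset>) (map b Bs')"
    by (rule sorted_wrt_map_strict[OF _ _ strict2]) (use Bs(1,2) B in auto)
  moreover have "a U \<subset> b W" if "U \<in> set As" "W \<in> set Bs'" for U W
  proof -
    have "a U \<subseteq> b B" using that As(2) Bs(2) B by (intro below) auto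
    also have "b B \<subset> b W" using that Bs(1,2) B by (intro strict2) auto
    finally show ?thesis .
  qed
  ultimately have "sorted_wrt (\<subset>) Ms" by (auto simp: Ms_def sorted_wrt_append)
  moreover have "set Ms \<subseteq> F" using As(2) Bs(2) B in1 in2 by (auto simp: Ms_def)
  ultimately have "enat (length Ms - 1) \<le> chain_length F" by (rule chain_length_ge)
  then show ?thesis using mn As(3) Bs(3) B by (simp add: Ms_def)
qed

lemma chain_length_le_card:
  assumes "finite F" shows "chain_length F \<le> enat (card F - 1)"
proof (rule chain_length_leI)
  fix Ms assume Ms: "sorted_wrt (\<subset>) Ms" "set Ms \<subseteq> F"
  have "distinct Ms" using Ms(1) by (induction Ms) auto
  then have "length Ms \<le> card F"
    using Ms(2) assms by (metis card_mono distinct_card)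
  then show "enat (length Ms - 1) \<le> enat (card F - 1)" by simp
qed

lemma chain_length_two:
  assumes "U \<subset> W" shows "chain_length {U, W} = 1"
proof (rule antisym)
  have "card {U, W} = 2" using assms by auto
  then show "chain_length {U, W} \<le> 1"
    using chain_length_le_card[of "{U, W}"] by (simp add: one_enat_def)
  show "1 \<le> chain_length {U, W}"
    using chain_length_ge[of "[U, W]" "{U, W}"] assms by (simp add: one_enat_def)
qed

section \<open>Submodules and homomorphisms\<close>

context module
begin

lemma submoduleI':
  assumes "H \<subseteq> carrier M" "\<zero>\<^bsub>M\<^esub> \<in> H"
    and "\<And>x y. x \<in> H \<Longrightarrow> y \<in> H \<Longrightarrow> x \<oplus>\<^bsub>M\<^esub> y \<in> H"
    and smult: "\<And>a x. a \<in> carrier R \<Longrightarrow> x \<in> H \<Longrightarrow> a \<odot>\<^bsub>M\<^esub> x \<in> H"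
  shows "submodule H R M"
proof (rule submoduleI)
  fix x assume x: "x \<in> H"
  then have "\<ominus>\<^bsub>M\<^esub> x = (\<ominus> \<one>) \<odot>\<^bsub>M\<^esub> x"
    using assms(1) by (subst smult_l_minus) auto
  then show "\<ominus>\<^bsub>M\<^esub> x \<in> H" using smult x by simp
qed (use assms in auto)

lemma submodule_zero_closed: "submodule H R M \<Longrightarrow> \<zero>\<^bsub>M\<^esub> \<in> H"
  using subgroup.one_closed[OF submodule.axioms(1)] by fastforce

lemma submodule_carrier: "submodule H R M \<Longrightarrow> x \<in> H \<Longrightarrow> x \<in> carrier M"
  using submoduleE(1) by blast

lemma submodule_minus_closed:
  "submodule H R M \<Longrightarrow> x \<in> H \<Longrightarrow> y \<in> H \<Longrightarrow> x \<ominus>\<^bsub>M\<^esub> y \<in> H"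
  by (simp add: a_minus_def submoduleE(3,5))

lemma minus_eq_zero_iff:
  assumes "x \<in> carrier M" "y \<in> carrier M"
  shows "x \<ominus>\<^bsub>M\<^esub> y = \<zero>\<^bsub>M\<^esub> \<longleftrightarrow> x = y"
  using assms M.minus_equality[of x "\<ominus>\<^bsub>M\<^esub> y"] by (auto simp: M.minus_eq M.r_neg)

lemma zero_submodule: "submodule {\<zero>\<^bsub>M\<^esub>} R M"
  by (rule submoduleI') auto

lemma submodule_Inter:
  assumes "\<And>H. H \<in> \<H> \<Longrightarrow> submodule H R M" "\<H> \<noteq> {}"
  shows "submodule (\<Inter>\<H>) R M"
proof (rule submoduleI')
  show "\<Inter>\<H> \<subseteq> carrier M" using assms submoduleE(1) by blast
qed (use assms submodule_zero_closed submoduleE(4,5) in blast)+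

lemma submodule_Int: "submodule H R M \<Longrightarrow> submodule K R M \<Longrightarrow> submodule (H \<inter> K) R M"
  using submodule_Inter[of "{H, K}"] by auto

lemma cyclic_submodule:
  assumes "x \<in> carrier M" shows "submodule ((\<lambda>r. r \<odot>\<^bsub>M\<^esub> x) ` carrier R) R M"
proof (rule submoduleI')
  show "\<zero>\<^bsub>M\<^esub> \<in> (\<lambda>r. r \<odot>\<^bsub>M\<^esub> x) ` carrier R"
    using assms by (intro image_eqI[of _ _ \<zero>]) auto
next
  fix u v assume "u \<in> (\<lambda>r. r \<odot>\<^bsub>M\<^esub> x) ` carrier R" "v \<in> (\<lambda>r. r \<odot>\<^bsub>M\<^esub> x) ` carrier R"
  then obtain r s where "r \<in> carrier R" "s \<in> carrier R" "u = r \<odot>\<^bsub>M\<^esub> x" "v = s \<odot>\<^bsub>M\<^esub> x" by auto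
  then show "u \<oplus>\<^bsub>M\<^esub> v \<in> (\<lambda>r. r \<odot>\<^bsub>M\<^esub> x) ` carrier R"
    using assms by (intro image_eqI[of _ _ "r \<oplus> s"]) (auto simp: smult_l_distr)
next
  fix a u assume "a \<in> carrier R" "u \<in> (\<lambda>r. r \<odot>\<^bsub>M\<^esub> x) ` carrier R"
  then obtain r where "a \<in> carrier R" "r \<in> carrier R" "u = r \<odot>\<^bsub>M\<^esub> x" by auto
  then show "a \<odot>\<^bsub>M\<^esub> u \<in> (\<lambda>r. r \<odot>\<^bsub>M\<^esub> x) ` carrier R"
    using assms by (intro image_eqI[of _ _ "a \<otimes> r"]) (auto simp: smult_assoc1)
qed (use assms in auto)

end

section \<open>Homomorphisms and isomorphisms of modules\<close>

locale module_morphism = M: module R M + N: module R N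
  for R (structure) and M and N and f +
  assumes hom: "f \<in> module_hom R M N"
begin

lemma f_closed [simp]: "x \<in> carrier M \<Longrightarrow> f x \<in> carrier N"
  and f_add [simp]: "x \<in> carrier M \<Longrightarrow> y \<in> carrier M \<Longrightarrow> f (x \<oplus>\<^bsub>M\<^esub> y) = f x \<oplus>\<^bsub>N\<^esub> f y"
  and f_smult [simp]: "r \<in> carrier R \<Longrightarrow> x \<in> carrier M \<Longrightarrow> f (r \<odot>\<^bsub>M\<^esub> x) = r \<odot>\<^bsub>N\<^esub> f x"
  using hom by (auto simp: module_hom_def)

lemma f_zero [simp]: "f \<zero>\<^bsub>M\<^esub> = \<zero>\<^bsub>N\<^esub>"
  using f_smult[of \<zero> "\<zero>\<^bsub>M\<^esub>"] by simp

lemma f_minus [simp]: "x \<in> carrier M \<Longrightarrow> f (\<ominus>\<^bsub>M\<^esub> x) = \<ominus>\<^bsub>N\<^esub> f x"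
  using f_smult[of "\<ominus> \<one>" x] by (simp add: M.smult_l_minus N.smult_l_minus)

lemma f_diff [simp]:
  "x \<in> carrier M \<Longrightarrow> y \<in> carrier M \<Longrightarrow> f (x \<ominus>\<^bsub>M\<^esub> y) = f x \<ominus>\<^bsub>N\<^esub> f y"
  by (simp add: a_minus_def)

lemma vimage_submodule:
  assumes "submodule H R N" shows "submodule {x \<in> carrier M. f x \<in> H} R M"
  using assms N.submodule_zero_closed N.submoduleE(4,5) by (intro M.submoduleI') auto

lemma image_submodule:
  assumes H: "submodule H R M" shows "submodule (f ` H) R N"
proof (rule N.submoduleI')
  show "\<zero>\<^bsub>N\<^esub> \<in> f ` H" using M.submodule_zero_closed[OF H] by (intro image_eqI[of _ _ "\<zero>\<^bsub>M\<^esub>"]) auto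
next
  fix u v assume "u \<in> f ` H" "v \<in> f ` H"
  then obtain x y where "x \<in> H" "y \<in> H" "u = f x" "v = f y" by auto
  then show "u \<oplus>\<^bsub>N\<^esub> v \<in> f ` H"
    using M.submodule_carrier[OF H] M.submoduleE(5)[OF H]
    by (intro image_eqI[of _ _ "x \<oplus>\<^bsub>M\<^esub> y"]) auto
next
  fix a u assume "a \<in> carrier R" "u \<in> f ` H"
  then obtain x where "a \<in> carrier R" "x \<in> H" "u = f x" by auto
  then show "a \<odot>\<^bsub>N\<^esub> u \<in> f ` H"
    using M.submodule_carrier[OF H] M.submoduleE(4)[OF H]
    by (intro image_eqI[of _ _ "a \<odot>\<^bsub>M\<^esub> x"]) auto
qed (use M.submodule_carrier[OF H] in auto)

lemma inv_into_hom:
  assumes "bij_betw f (carrier M) (carrier N)"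
  shows "inv_into (carrier M) f \<in> module_hom R N M"
proof -
  let ?g = "inv_into (carrier M) f"
  have inj: "inj_on f (carrier M)" and surj: "f ` carrier M = carrier N"
    using assms by (auto simp: bij_betw_def)
  have g: "?g y \<in> carrier M" "f (?g y) = y" if "y \<in> carrier N" for y
    using that surj by (auto simp: inv_into_into f_inv_into_f)
  have gf: "?g (f x) = x" if "x \<in> carrier M" for x using inj that by simp
  show ?thesis
    unfolding module_hom_def
  proof (intro CollectI conjI ballI)
    fix u v assume uv: "u \<in> carrier N" "v \<in> carrier N"
    then show "?g (u \<oplus>\<^bsub>N\<^esub> v) = ?g u \<oplus>\<^bsub>M\<^esub> ?g v"
      using gf[of "?g u \<oplus>\<^bsub>M\<^esub> ?g v"] g by simp
  next
    fix r u assume "r \<in> carrier R" "u \<in> carrier N"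
    then show "?g (r \<odot>\<^bsub>N\<^esub> u) = r \<odot>\<^bsub>M\<^esub> ?g u"
      using gf[of "r \<odot>\<^bsub>M\<^esub> ?g u"] g by simp
  qed (use g in auto)
qed

end

lemma module_morphismI:
  "module R M \<Longrightarrow> module R N \<Longrightarrow> f \<in> module_hom R M N \<Longrightarrow> module_morphism R M N f"
  by (simp add: module_morphism_def module_morphism_axioms_def)

lemma module_hom_comp:
  "f \<in> module_hom R M N \<Longrightarrow> g \<in> module_hom R N P \<Longrightarrow> (\<lambda>x. g (f x)) \<in> module_hom R M P"
  by (auto simp: module_hom_def Pi_iff)

lemma module_iso_sym:
  assumes "module R M" "module R N" "module_iso R M N" shows "module_iso R N M"
proof -
  obtain f where f: "f \<in> module_hom R M N" "bij_betw f (carrier M) (carrier N)"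
    using assms(3) by (auto simp: module_iso_def)
  interpret module_morphism R M N f by (rule module_morphismI[OF assms(1,2) f(1)])
  show ?thesis
    unfolding module_iso_def using inv_into_hom[OF f(2)] bij_betw_inv_into[OF f(2)] by blast
qed

lemma module_iso_trans:
  assumes "module_iso R M N" "module_iso R N P" shows "module_iso R M P"
proof -
  obtain f g where "f \<in> module_hom R M N" "bij_betw f (carrier M) (carrier N)"
    "g \<in> module_hom R N P" "bij_betw g (carrier N) (carrier P)"
    using assms by (auto simp: module_iso_def)
  then have "(\<lambda>x. g (f x)) \<in> module_hom R M P" "bij_betw (\<lambda>x. g (f x)) (carrier M) (carrier P)"
    using module_hom_comp bij_betw_trans[of f _ _ g] by (auto simp: comp_def)
  then show ?thesis unfolding module_iso_def by blast
qed

lemma module_iso_refl: "module_iso R M M"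
  unfolding module_iso_def by (intro bexI[of _ "\<lambda>x. x"]) (auto simp: module_hom_def bij_betw_def)

text \<open>Both modules are \<open>P\<close> modulo the common kernel. The map sending
  \<open>f x\<close> to \<open>g x\<close> is well defined and injective because \<open>f\<close>
  and \<open>g\<close> identify the same pairs, which is the fact \<open>eq\<close>. This compares
  different copies of k without forming quotients.\<close>

lemma module_iso_of_same_kernel:
  assumes "module R P" "module R M" "module R N"
    and f: "f \<in> module_hom R P M" "f ` carrier P = carrier M"
    and g: "g \<in> module_hom R P N" "g ` carrier P = carrier N"
    and ker: "\<And>x. x \<in> carrier P \<Longrightarrow> f x = \<zero>\<^bsub>M\<^esub> \<longleftrightarrow> g x = \<zero>\<^bsub>N\<^esub>"
  shows "module_iso R M N"
proof -
  interpret f: module_morphism R P M f by (rule module_morphismI[OF assms(1,2) f(1)])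
  interpret g: module_morphism R P N g by (rule module_morphismI[OF assms(1,3) g(1)])
  define h where "h y = g (inv_into (carrier P) f y)" for y
  have eq: "f x = f y \<longleftrightarrow> g x = g y" if "x \<in> carrier P" "y \<in> carrier P" for x y
  proof -
    have "f x = f y \<longleftrightarrow> f (x \<ominus>\<^bsub>P\<^esub> y) = \<zero>\<^bsub>M\<^esub>" using that by (simp add: f.N.minus_eq_zero_iff)
    also have "\<dots> \<longleftrightarrow> g (x \<ominus>\<^bsub>P\<^esub> y) = \<zero>\<^bsub>N\<^esub>" using that by (intro ker) simp
    also have "\<dots> \<longleftrightarrow> g x = g y" using that by (simp add: g.N.minus_eq_zero_iff)
    finally show ?thesis .
  qed
  have hf: "h (f x) = g x" if "x \<in> carrier P" for x
    unfolding h_def using that by (subst eq[symmetric]) (auto intro: inv_into_into f_inv_into_f)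
  have ex: "\<exists>x\<in>carrier P. y = f x" if "y \<in> carrier M" for y using that f(2) by blast
  have "h \<in> module_hom R M N"
    unfolding module_hom_def
  proof (intro CollectI conjI ballI)
    fix u v assume "u \<in> carrier M" "v \<in> carrier M"
    then obtain x y where xy: "x \<in> carrier P" "y \<in> carrier P" "u = f x" "v = f y" using ex by metis
    then show "h (u \<oplus>\<^bsub>M\<^esub> v) = h u \<oplus>\<^bsub>N\<^esub> h v"
      using hf[of "x \<oplus>\<^bsub>P\<^esub> y"] by (simp add: hf)
  next
    fix r u assume r: "r \<in> carrier R" and "u \<in> carrier M"
    then obtain x where "x \<in> carrier P" "u = f x" using ex by metis
    then show "h (r \<odot>\<^bsub>M\<^esub> u) = r \<odot>\<^bsub>N\<^esub> h u"
      using hf[of "r \<odot>\<^bsub>P\<^esub> x"] r by (simp add: hf)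
  qed (use ex hf in force)
  moreover have "bij_betw h (carrier M) (carrier N)"
  proof (rule bij_betw_imageI)
    show "inj_on h (carrier M)"
    proof (rule inj_onI)
      fix u v assume "u \<in> carrier M" "v \<in> carrier M" "h u = h v"
      then show "u = v" using ex eq hf by metis
    qed
    have "h ` carrier M = (\<lambda>x. h (f x)) ` carrier P" using f(2) by (simp flip: f(2) add: image_image)
    also have "\<dots> = carrier N" using g(2) hf by simp
    finally show "h ` carrier M = carrier N" .
  qed
  ultimately show ?thesis by (auto simp: module_iso_def)
qed

section \<open>Finite generation\<close>

text \<open>Generation by an intersection makes minimality immediate, so hulls can be compared
  without handling linear combinations. \<open>finitely_generated_iff\<close> connects it with the
  finite sums in \<open>finitely_generated\<close>.\<close>

definition module_hull :: "('r, 'x) ring_scheme \<Rightarrow> ('r, 'm, 'y) module_scheme \<Rightarrow> 'm set \<Rightarrow> 'm set" where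
  "module_hull R M S = \<Inter>{H. submodule H R M \<and> S \<subseteq> H}"

context module
begin

lemma module_hull_minimal: "submodule H R M \<Longrightarrow> S \<subseteq> H \<Longrightarrow> module_hull R M S \<subseteq> H"
  by (auto simp: module_hull_def)

lemma module_hull_superset: "S \<subseteq> module_hull R M S"
  by (auto simp: module_hull_def)

lemma module_hull_submodule:
  "S \<subseteq> carrier M \<Longrightarrow> submodule (module_hull R M S) R M"
  unfolding module_hull_def by (rule submodule_Inter) (use carrier_is_submodule in auto)

lemma module_hull_empty: "module_hull R M {} = {\<zero>\<^bsub>M\<^esub>}"
proof
  show "module_hull R M {} \<subseteq> {\<zero>\<^bsub>M\<^esub>}" by (rule module_hull_minimal[OF zero_submodule]) simp
  show "{\<zero>\<^bsub>M\<^esub>} \<subseteq> module_hull R M {}"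
    using submodule_zero_closed[OF module_hull_submodule] by simp
qed

text \<open>By minimality of the hull it is enough that the elements of this form make up a
  submodule containing \<open>s\<close> and \<open>S\<close>. Splitting off one generator is the
  induction step both for linear combinations and for the bound on the rank.\<close>

lemma module_hull_insert:
  assumes s: "s \<in> carrier M" and S: "S \<subseteq> carrier M" and x: "x \<in> module_hull R M (insert s S)"
  obtains c y where "c \<in> carrier R" "y \<in> module_hull R M S" "x = c \<odot>\<^bsub>M\<^esub> s \<oplus>\<^bsub>M\<^esub> y"
proof -
  note H = module_hull_submodule[OF S]
  let ?K = "{c \<odot>\<^bsub>M\<^esub> s \<oplus>\<^bsub>M\<^esub> y | c y. c \<in> carrier R \<and> y \<in> module_hull R M S}"
  have "submodule ?K R M"
  proof (rule submoduleI')
    show "?K \<subseteq> carrier M" using s submodule_carrier[OF H] by auto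
    show "\<zero>\<^bsub>M\<^esub> \<in> ?K"
      using s submodule_zero_closed[OF H] by (intro CollectI exI[of _ \<zero>] exI[of _ "\<zero>\<^bsub>M\<^esub>"]) auto
  next
    fix u v assume "u \<in> ?K" "v \<in> ?K"
    then obtain c d y z where *: "c \<in> carrier R" "d \<in> carrier R" "y \<in> module_hull R M S" "z \<in> module_hull R M S"
      "u = c \<odot>\<^bsub>M\<^esub> s \<oplus>\<^bsub>M\<^esub> y" "v = d \<odot>\<^bsub>M\<^esub> s \<oplus>\<^bsub>M\<^esub> z" by blast
    have "u \<oplus>\<^bsub>M\<^esub> v = (c \<oplus> d) \<odot>\<^bsub>M\<^esub> s \<oplus>\<^bsub>M\<^esub> (y \<oplus>\<^bsub>M\<^esub> z)"
      using * s submodule_carrier[OF H] by (simp add: smult_l_distr M.a_ac)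
    then show "u \<oplus>\<^bsub>M\<^esub> v \<in> ?K"
      using * submoduleE(5)[OF H] by (intro CollectI exI[of _ "c \<oplus> d"] exI[of _ "y \<oplus>\<^bsub>M\<^esub> z"]) auto
  next
    fix a u assume a: "a \<in> carrier R" and "u \<in> ?K"
    then obtain c y where *: "c \<in> carrier R" "y \<in> module_hull R M S" "u = c \<odot>\<^bsub>M\<^esub> s \<oplus>\<^bsub>M\<^esub> y" by blast
    have "a \<odot>\<^bsub>M\<^esub> u = (a \<otimes> c) \<odot>\<^bsub>M\<^esub> s \<oplus>\<^bsub>M\<^esub> a \<odot>\<^bsub>M\<^esub> y"
      using * a s submodule_carrier[OF H] by (simp add: smult_r_distr smult_assoc1)
    then show "a \<odot>\<^bsub>M\<^esub> u \<in> ?K"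
      using * a submoduleE(4)[OF H] by (intro CollectI exI[of _ "a \<otimes> c"] exI[of _ "a \<odot>\<^bsub>M\<^esub> y"]) auto
  qed
  moreover have "insert s S \<subseteq> ?K"
  proof -
    have "s = \<one> \<odot>\<^bsub>M\<^esub> s \<oplus>\<^bsub>M\<^esub> \<zero>\<^bsub>M\<^esub>" using s by simp
    then have "s \<in> ?K" using submodule_zero_closed[OF H] R.one_closed by blast
    moreover have "y \<in> ?K" if "y \<in> S" for y
    proof -
      have "y = \<zero> \<odot>\<^bsub>M\<^esub> s \<oplus>\<^bsub>M\<^esub> y" using s S that by auto
      then show ?thesis using module_hull_superset that R.zero_closed by blast
    qed
    ultimately show ?thesis by blast
  qed
  ultimately have "x \<in> ?K" using module_hull_minimal x by blast
  then show thesis using that by blast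
qed

lemma submodule_finsum_closed:
  assumes H: "submodule H R M" and "finite S" "S \<subseteq> H" "c \<in> S \<rightarrow> carrier R"
  shows "(\<Oplus>\<^bsub>M\<^esub>s\<in>S. c s \<odot>\<^bsub>M\<^esub> s) \<in> H"
  using assms(2-4)
proof (induction S)
  case empty
  then show ?case using submodule_zero_closed[OF H] by simp
next
  case (insert s S)
  have "(\<lambda>s. c s \<odot>\<^bsub>M\<^esub> s) \<in> S \<rightarrow> carrier M"
    using insert.prems submodule_carrier[OF H] by (intro funcsetI smult_closed) auto
  moreover have "c s \<odot>\<^bsub>M\<^esub> s \<in> H"
    using insert.prems by (intro submoduleE(4)[OF H]) auto
  ultimately show ?case
    using insert submoduleE(5)[OF H] submodule_carrier[OF H] by (simp add: M.finsum_insert)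
qed

lemma module_hull_finsum:
  assumes "finite S" "S \<subseteq> carrier M" "x \<in> module_hull R M S"
  shows "\<exists>c \<in> S \<rightarrow> carrier R. x = (\<Oplus>\<^bsub>M\<^esub>s\<in>S. c s \<odot>\<^bsub>M\<^esub> s)"
  using assms
proof (induction S arbitrary: x)
  case empty
  then show ?case by (simp add: module_hull_empty)
next
  case (insert s S)
  then obtain c y where cy: "c \<in> carrier R" "y \<in> module_hull R M S" "x = c \<odot>\<^bsub>M\<^esub> s \<oplus>\<^bsub>M\<^esub> y"
    by (elim module_hull_insert[rotated 2]) auto
  then obtain d where d: "d \<in> S \<rightarrow> carrier R" "y = (\<Oplus>\<^bsub>M\<^esub>s\<in>S. d s \<odot>\<^bsub>M\<^esub> s)"
    using insert by auto
  have S: "\<And>i. i \<in> S \<Longrightarrow> i \<in> carrier M" "s \<in> carrier M" using insert.prems by auto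
  have dM: "(\<lambda>s. d s \<odot>\<^bsub>M\<^esub> s) \<in> S \<rightarrow> carrier M"
    using d(1) S by (intro funcsetI smult_closed) auto
  define e where "e = d(s := c)"
  have e: "e \<in> insert s S \<rightarrow> carrier R" using d(1) cy(1) by (auto simp: e_def Pi_iff)
  have eM: "(\<lambda>s. e s \<odot>\<^bsub>M\<^esub> s) \<in> S \<rightarrow> carrier M"
    using e S by (intro funcsetI smult_closed) auto
  have "(\<Oplus>\<^bsub>M\<^esub>i\<in>S. e i \<odot>\<^bsub>M\<^esub> i) = y"
    unfolding d(2) using dM insert.hyps by (intro M.finsum_cong') (auto simp: e_def)
  then have "x = (\<Oplus>\<^bsub>M\<^esub>i\<in>insert s S. e i \<odot>\<^bsub>M\<^esub> i)"
    using M.finsum_insert[OF insert.hyps eM] S cy by (simp add: e_def)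
  then show ?case using e by blast
qed

end

lemma finitely_generated_iff:
  fixes M :: "('r, 'm) module"
  assumes "module R M"
  shows "finitely_generated R M \<longleftrightarrow> (\<exists>S. finite S \<and> S \<subseteq> carrier M \<and> module_hull R M S = carrier M)"
proof -
  interpret module R M by fact
  have "(\<forall>x\<in>carrier M. \<exists>c \<in> S \<rightarrow> carrier R. x = (\<Oplus>\<^bsub>M\<^esub>s\<in>S. c s \<odot>\<^bsub>M\<^esub> s)) \<longleftrightarrow> module_hull R M S = carrier M"
    if S: "finite S" "S \<subseteq> carrier M" for S
  proof
    assume "module_hull R M S = carrier M"
    then show "\<forall>x\<in>carrier M. \<exists>c \<in> S \<rightarrow> carrier R. x = (\<Oplus>\<^bsub>M\<^esub>s\<in>S. c s \<odot>\<^bsub>M\<^esub> s)"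
      using module_hull_finsum[OF S] by simp
  next
    assume *: "\<forall>x\<in>carrier M. \<exists>c \<in> S \<rightarrow> carrier R. x = (\<Oplus>\<^bsub>M\<^esub>s\<in>S. c s \<odot>\<^bsub>M\<^esub> s)"
    show "module_hull R M S = carrier M"
    proof
      show "module_hull R M S \<subseteq> carrier M" using module_hull_submodule[OF S(2)] submoduleE(1) by blast
      show "carrier M \<subseteq> module_hull R M S"
      proof
        fix x assume "x \<in> carrier M"
        then obtain c where "c \<in> S \<rightarrow> carrier R" "x = (\<Oplus>\<^bsub>M\<^esub>s\<in>S. c s \<odot>\<^bsub>M\<^esub> s)" using * by blast
        then show "x \<in> module_hull R M S"
          using submodule_finsum_closed[OF module_hull_submodule[OF S(2)] S(1) module_hull_superset] by simp
      qed
    qed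
  qed
  then show ?thesis unfolding finitely_generated_def by blast
qed

lemma cyclic_finitely_generated:
  fixes M :: "('r, 'm) module"
  assumes "module R M" "x \<in> carrier M" "carrier M = (\<lambda>r. r \<odot>\<^bsub>M\<^esub> x) ` carrier R"
  shows "finitely_generated R M"
proof -
  interpret module R M by fact
  have H: "submodule (module_hull R M {x}) R M" using assms(2) by (intro module_hull_submodule) simp
  have "x \<in> module_hull R M {x}" using module_hull_superset[of "{x}"] by simp
  then have "carrier M \<subseteq> module_hull R M {x}" using submoduleE(4)[OF H] unfolding assms(3) by blast
  then have "module_hull R M {x} = carrier M" using submoduleE(1)[OF H] by blast
  then show ?thesis
    unfolding finitely_generated_iff[OF assms(1)] using assms(2) by (intro exI[of _ "{x}"]) simp
qed

text \<open>If no finite set generates M, the hull of any finite set misses an element. Adjoining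
  such elements one at a time produces strictly increasing hulls, hence chains of every
  length.\<close>

lemma finitely_generated_of_finite_length:
  fixes M :: "('r, 'm) module"
  assumes "module R M" and len: "module_length R M \<noteq> \<infinity>"
  shows "finitely_generated R M"
proof (rule ccontr)
  interpret module R M by fact
  let ?h = "module_hull R M"
  assume not_fg: "\<not> finitely_generated R M"
  \<comment> \<open>The last hull is kept outside \<open>Ms\<close> because it is the one to be
    enlarged next; with it the chain has n + 1 entries and n steps.\<close>
  have chain: "\<exists>S Ms. finite S \<and> S \<subseteq> carrier M \<and> sorted_wrt (\<subset>) (Ms @ [?h S]) \<and>
          (\<forall>N\<in>set Ms. submodule N R M) \<and> length Ms = n" for n
  proof (induction n)
    case 0
    show ?case by (intro exI[of _ "{}"] exI[of _ "[]"]) simp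
  next
    case (Suc n)
    then obtain S Ms where S: "finite S" "S \<subseteq> carrier M" "sorted_wrt (\<subset>) (Ms @ [?h S])"
      "\<forall>N\<in>set Ms. submodule N R M" "length Ms = n" by blast
    have "module_hull R M S \<noteq> carrier M" using not_fg S(1,2) finitely_generated_iff[OF assms(1)] by blast
    moreover have "module_hull R M S \<subseteq> carrier M" using submoduleE(1)[OF module_hull_submodule[OF S(2)]] .
    ultimately obtain x where x: "x \<in> carrier M" "x \<notin> module_hull R M S" by blast
    have "module_hull R M S \<subseteq> module_hull R M (insert x S)" "x \<in> module_hull R M (insert x S)"
      by (auto simp: module_hull_def)
    with x(2) have less: "module_hull R M S \<subset> module_hull R M (insert x S)" by blast
    have "sorted_wrt (\<subset>) ((Ms @ [?h S]) @ [?h (insert x S)])"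
      unfolding sorted_wrt_append[of _ "Ms @ _"] using S(3) less by (auto simp: sorted_wrt_append)
    then show ?case
      using S x(1) module_hull_submodule[OF S(2)]
      by (intro exI[of _ "insert x S"] exI[of _ "Ms @ [?h S]"]) auto
  qed
  have "enat n \<le> module_length R M" for n
  proof -
    obtain S Ms where S: "S \<subseteq> carrier M" "sorted_wrt (\<subset>) (Ms @ [?h S])"
      "\<forall>N\<in>set Ms. submodule N R M" "length Ms = n" using chain[of n] by blast
    have "enat (length (Ms @ [?h S]) - 1) \<le> module_length R M"
      unfolding module_length_def
      by (rule SUP_upper) (use S module_hull_submodule[OF S(1)] in auto)
    then show ?thesis using S(4) by simp
  qed
  then have "module_length R M = \<infinity>"
    by (cases "module_length R M") (metis Suc_n_not_le_n enat_ord_simps(1), simp)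
  then show False using len by simp
qed

section \<open>Length and rank\<close>

lemma enat_le_finite: "(x :: enat) \<le> y \<Longrightarrow> y \<noteq> \<infinity> \<Longrightarrow> x \<noteq> \<infinity>"
  by (cases x; cases y) auto

text \<open>Equivalently, the quotient of M by \<open>N\<close> has no
  \<open>T\<close>-torsion.\<close>

definition closed_submodules ::
  "('r, 'x) ring_scheme \<Rightarrow> 'r set \<Rightarrow> ('r, 'm, 'y) module_scheme \<Rightarrow> 'm set set"
where
  "closed_submodules R T M =
     {N. submodule N R M \<and> (\<forall>r\<in>T. \<forall>x\<in>carrier M. r \<odot>\<^bsub>M\<^esub> x \<in> N \<longrightarrow> x \<in> N)}"

text \<open>For a submonoid \<open>T\<close> and a submodule \<open>N\<close> this is the least
  closed submodule containing \<open>N\<close>, or the preimage in M of the localization of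
  \<open>N\<close>. It is needed because images of closed submodules need not be closed.\<close>

definition saturation ::
  "'r set \<Rightarrow> ('r, 'm, 'y) module_scheme \<Rightarrow> 'm set \<Rightarrow> 'm set"
where
  "saturation T M N = {x \<in> carrier M. \<exists>r\<in>T. r \<odot>\<^bsub>M\<^esub> x \<in> N}"

definition rel_length :: "('r, 'x) ring_scheme \<Rightarrow> 'r set \<Rightarrow> ('r, 'm, 'y) module_scheme \<Rightarrow> enat" where
  "rel_length R T M = chain_length (closed_submodules R T M)"

lemma rel_length_one:
  assumes "module R M" shows "rel_length R {\<one>\<^bsub>R\<^esub>} M = module_length R M"
proof -
  interpret module R M by fact
  have "closed_submodules R {\<one>\<^bsub>R\<^esub>} M = {N. submodule N R M}"
    by (auto simp: closed_submodules_def)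
  then show ?thesis
    unfolding rel_length_def chain_length_def module_length_def
    by (intro arg_cong[where f = Sup] arg_cong2[where f = image] refl) auto
qed

context module
begin

lemma closed_submodulesD:
  assumes "N \<in> closed_submodules R T M"
  shows "submodule N R M" "r \<in> T \<Longrightarrow> x \<in> carrier M \<Longrightarrow> r \<odot>\<^bsub>M\<^esub> x \<in> N \<Longrightarrow> x \<in> N"
  using assms by (auto simp: closed_submodules_def)

lemma closed_submodules_nonempty: "closed_submodules R T M \<noteq> {}"
  using carrier_is_submodule by (auto simp: closed_submodules_def)

lemma saturation_superset:
  assumes "submonoid T R" "N \<subseteq> carrier M" shows "N \<subseteq> saturation T M N"
proof
  fix x assume "x \<in> N"
  with assms show "x \<in> saturation T M N"
    unfolding saturation_def
    by (intro CollectI conjI bexI[of _ \<one>] submonoid.one_closed[OF assms(1)]) auto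
qed

lemma saturation_minimal:
  "K \<in> closed_submodules R T M \<Longrightarrow> N \<subseteq> K \<Longrightarrow> saturation T M N \<subseteq> K"
  using closed_submodulesD(2) by (fastforce simp: saturation_def)

lemma saturation_mono: "N \<subseteq> K \<Longrightarrow> saturation T M N \<subseteq> saturation T M K"
  by (auto simp: saturation_def)

text \<open>Multipliers are combined by multiplication: if \<open>r\<close> moves x into
  \<open>N\<close> and \<open>s\<close> moves y into \<open>N\<close>, then
  \<open>r \<otimes> s\<close> moves the sum into \<open>N\<close>. Iterated saturation collapses
  for the same reason.\<close>

lemma saturation_closed:
  assumes T: "submonoid T R" and N: "submodule N R M"
  shows "saturation T M N \<in> closed_submodules R T M"
proof -
  interpret T: submonoid T R by (rule T)
  have TR: "r \<in> carrier R" if "r \<in> T" for r using that T.subset by blast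
  have "submodule (saturation T M N) R M"
  proof (rule submoduleI')
    show "saturation T M N \<subseteq> carrier M" by (auto simp: saturation_def)
    show "\<zero>\<^bsub>M\<^esub> \<in> saturation T M N"
      using submodule_zero_closed[OF N] bexI[OF _ T.one_closed, of "\<lambda>r. r \<odot>\<^bsub>M\<^esub> \<zero>\<^bsub>M\<^esub> \<in> N"]
      by (simp add: saturation_def)
  next
    fix x y assume "x \<in> saturation T M N" "y \<in> saturation T M N"
    then obtain r s where *: "x \<in> carrier M" "y \<in> carrier M" "r \<in> T" "s \<in> T"
      "r \<odot>\<^bsub>M\<^esub> x \<in> N" "s \<odot>\<^bsub>M\<^esub> y \<in> N" by (auto simp: saturation_def)
    have "(r \<otimes> s) \<odot>\<^bsub>M\<^esub> (x \<oplus>\<^bsub>M\<^esub> y) = s \<odot>\<^bsub>M\<^esub> (r \<odot>\<^bsub>M\<^esub> x) \<oplus>\<^bsub>M\<^esub> r \<odot>\<^bsub>M\<^esub> (s \<odot>\<^bsub>M\<^esub> y)"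
      using * TR by (simp add: smult_r_distr smult_assoc1[symmetric] R.m_comm)
    also have "\<dots> \<in> N" using * TR by (simp add: submoduleE(4,5)[OF N])
    finally show "x \<oplus>\<^bsub>M\<^esub> y \<in> saturation T M N"
      using * by (auto simp: saturation_def intro!: bexI[of _ "r \<otimes> s"])
  next
    fix a x assume a: "a \<in> carrier R" and "x \<in> saturation T M N"
    then obtain r where *: "x \<in> carrier M" "r \<in> T" "r \<odot>\<^bsub>M\<^esub> x \<in> N" by (auto simp: saturation_def)
    have "r \<odot>\<^bsub>M\<^esub> (a \<odot>\<^bsub>M\<^esub> x) = a \<odot>\<^bsub>M\<^esub> (r \<odot>\<^bsub>M\<^esub> x)"
      using * a TR by (simp add: smult_assoc1[symmetric] R.m_comm)
    also have "\<dots> \<in> N" using * a by (simp add: submoduleE(4)[OF N])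
    finally show "a \<odot>\<^bsub>M\<^esub> x \<in> saturation T M N"
      using * a by (auto simp: saturation_def)
  qed
  moreover have "x \<in> saturation T M N"
    if x: "r \<in> T" "x \<in> carrier M" "r \<odot>\<^bsub>M\<^esub> x \<in> saturation T M N" for r x
  proof -
    obtain s where s: "s \<in> T" "s \<odot>\<^bsub>M\<^esub> (r \<odot>\<^bsub>M\<^esub> x) \<in> N" using x by (auto simp: saturation_def)
    then have "(s \<otimes> r) \<odot>\<^bsub>M\<^esub> x \<in> N" using x TR by (simp add: smult_assoc1)
    then show ?thesis using x s by (auto simp: saturation_def intro!: bexI[of _ "s \<otimes> r"])
  qed
  ultimately show ?thesis by (auto simp: closed_submodules_def)
qed

end

context module_morphism
begin

lemma vimage_closed:
  assumes "T \<subseteq> carrier R" "H \<in> closed_submodules R T N"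
  shows "{x \<in> carrier M. f x \<in> H} \<in> closed_submodules R T M"
  unfolding closed_submodules_def
proof (intro CollectI conjI ballI impI)
  show "submodule {x \<in> carrier M. f x \<in> H} R M"
    by (rule vimage_submodule[OF N.closed_submodulesD(1)[OF assms(2)]])
next
  fix r x assume "r \<in> T" "x \<in> carrier M" "r \<odot>\<^bsub>M\<^esub> x \<in> {x \<in> carrier M. f x \<in> H}"
  then show "f x \<in> H"
    using assms(1) N.closed_submodulesD(2)[OF assms(2), of r "f x"] by auto
qed auto

text \<open>Pulling back recovers \<open>H\<close>, so taking saturated images loses no strict
  inclusion. If \<open>r\<close> times \<open>f x\<close> equals \<open>f h\<close> with h in
  \<open>H\<close>, injectivity gives that \<open>r\<close> times x is h, and closedness of
  \<open>H\<close> cancels \<open>r\<close>.\<close>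

lemma vimage_saturation_image:
  assumes T: "submonoid T R" and inj: "inj_on f (carrier M)" and H: "H \<in> closed_submodules R T M"
  shows "{x \<in> carrier M. f x \<in> saturation T N (f ` H)} = H"
proof -
  have TR: "T \<subseteq> carrier R" using submonoid.subset[OF T] .
  have HM: "H \<subseteq> carrier M" using M.closed_submodulesD(1)[OF H] M.submoduleE(1) by blast
  show ?thesis
  proof (intro Set.set_eqI iffI)
    fix x assume "x \<in> {x \<in> carrier M. f x \<in> saturation T N (f ` H)}"
    then obtain r h where *: "x \<in> carrier M" "r \<in> T" "h \<in> H" "r \<odot>\<^bsub>N\<^esub> f x = f h"
      by (auto simp: saturation_def)
    then have "f (r \<odot>\<^bsub>M\<^esub> x) = f h" using TR by auto
    then have "r \<odot>\<^bsub>M\<^esub> x = h" using inj_onD[OF inj, of "r \<odot>\<^bsub>M\<^esub> x" h] * TR HM by auto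
    then show "x \<in> H" using * M.closed_submodulesD(2)[OF H] by auto
  next
    fix x assume "x \<in> H"
    moreover have "f ` H \<subseteq> saturation T N (f ` H)"
      using HM by (intro N.saturation_superset[OF T]) auto
    ultimately show "x \<in> {x \<in> carrier M. f x \<in> saturation T N (f ` H)}" using HM by auto
  qed
qed

lemma saturation_image_strict:
  assumes T: "submonoid T R" and inj: "inj_on f (carrier M)"
    and "H \<in> closed_submodules R T M" "K \<in> closed_submodules R T M" "H \<subset> K"
  shows "saturation T N (f ` H) \<subset> saturation T N (f ` K)"
proof -
  have "saturation T N (f ` H) \<subseteq> saturation T N (f ` K)"
    using assms(5) by (intro N.saturation_mono) auto
  moreover have "saturation T N (f ` H) \<noteq> saturation T N (f ` K)"
    using vimage_saturation_image[OF T inj] assms(3-5) by (metis psubset_eq)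
  ultimately show ?thesis by blast
qed

lemma vimage_strict:
  assumes surj: "f ` carrier M = carrier N" and "K \<subseteq> carrier N" "H \<subset> K"
  shows "{x \<in> carrier M. f x \<in> H} \<subset> {x \<in> carrier M. f x \<in> K}"
proof -
  obtain y where "y \<in> K" "y \<notin> H" using assms(3) by blast
  moreover from this obtain x where "x \<in> carrier M" "y = f x" using assms(1,2) by blast
  ultimately show ?thesis using assms(3) by blast
qed

lemma rel_length_le_of_inj:
  assumes T: "submonoid T R" and inj: "inj_on f (carrier M)"
  shows "rel_length R T M \<le> rel_length R T N"
  unfolding rel_length_def
proof (rule chain_length_mono[where \<alpha> = "\<lambda>H. saturation T N (f ` H)"])
  fix H assume "H \<in> closed_submodules R T M"
  then show "saturation T N (f ` H) \<in> closed_submodules R T N"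
    by (intro N.saturation_closed[OF T] image_submodule M.closed_submodulesD(1))
qed (rule saturation_image_strict[OF T inj])

lemma rel_length_le_of_surj:
  assumes T: "submonoid T R" and surj: "f ` carrier M = carrier N"
  shows "rel_length R T N \<le> rel_length R T M"
  unfolding rel_length_def
proof (rule chain_length_mono[where \<alpha> = "\<lambda>H. {x \<in> carrier M. f x \<in> H}"])
  fix H assume "H \<in> closed_submodules R T N"
  then show "{x \<in> carrier M. f x \<in> H} \<in> closed_submodules R T M"
    by (rule vimage_closed[OF submonoid.subset[OF T]])
next
  fix H K assume "K \<in> closed_submodules R T N" "H \<subset> K"
  then show "{x \<in> carrier M. f x \<in> H} \<subset> {x \<in> carrier M. f x \<in> K}"
    using N.closed_submodulesD(1) N.submoduleE(1) by (intro vimage_strict[OF surj]) auto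
qed

end

section \<open>Isomorphism invariance and additivity on short exact sequences\<close>

lemma rel_length_iso:
  assumes T: "submonoid T R" and "module R M" "module R N" "module_iso R M N"
  shows "rel_length R T M = rel_length R T N"
proof -
  obtain f where f: "f \<in> module_hom R M N" "bij_betw f (carrier M) (carrier N)"
    using assms(4) by (auto simp: module_iso_def)
  interpret module_morphism R M N f by (rule module_morphismI[OF assms(2,3) f(1)])
  show ?thesis
    using rel_length_le_of_inj[OF T] rel_length_le_of_surj[OF T] f(2)
    by (auto simp: bij_betw_def intro: antisym)
qed

text \<open>A closed submodule is replaced by its trace on \<open>M'\<close> and the saturation of
  its image in \<open>M''\<close>. Let closed submodules N and K with N inside K agree in both. For
  x in K there are r in \<open>T\<close> and n in N such that r x - n is killed by \<open>g\<close>;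
  this element lies in K and comes from \<open>M'\<close>, hence lies in N. So r x is in N, and
  closedness cancels r.\<close>

lemma rel_length_subadd:
  assumes T: "submonoid T R" and mods: "module R M'" "module R M" "module R M''"
    and ex: "short_exact R M' f M g M''"
  shows "rel_length R T M \<le> rel_length R T M' + rel_length R T M''"
proof -
  have f: "f \<in> module_hom R M' M" and g: "g \<in> module_hom R M M''" and inj: "inj_on f (carrier M')"
    and ker: "f ` carrier M' = {x \<in> carrier M. g x = \<zero>\<^bsub>M''\<^esub>}" and surj: "g ` carrier M = carrier M''"
    using ex by (auto simp: short_exact_def)
  interpret f: module_morphism R M' M f by (rule module_morphismI[OF mods(1,2) f])
  interpret g: module_morphism R M M'' g by (rule module_morphismI[OF mods(2,3) g])
  have TR: "r \<in> carrier R" if "r \<in> T" for r using submonoid.subset[OF T] that by blast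
  show ?thesis
    unfolding rel_length_def
  proof (rule chain_length_subadd[where \<alpha> = "\<lambda>N. {x \<in> carrier M'. f x \<in> N}"
        and \<beta> = "\<lambda>N. saturation T M'' (g ` N)"])
    fix N K assume N: "N \<in> closed_submodules R T M" and K: "K \<in> closed_submodules R T M" and NK: "N \<subset> K"
    show "{x \<in> carrier M'. f x \<in> N} \<subseteq> {x \<in> carrier M'. f x \<in> K}" using NK by blast
    show "saturation T M'' (g ` N) \<subseteq> saturation T M'' (g ` K)"
      using NK by (intro g.N.saturation_mono) auto
    have N': "submodule N R M" and K': "submodule K R M"
      using N K f.N.closed_submodulesD(1) by auto
    show "{x \<in> carrier M'. f x \<in> N} \<noteq> {x \<in> carrier M'. f x \<in> K} \<or>
      saturation T M'' (g ` N) \<noteq> saturation T M'' (g ` K)"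
    proof (rule ccontr)
      assume "\<not> ?thesis"
      then have eq: "{x \<in> carrier M'. f x \<in> N} = {x \<in> carrier M'. f x \<in> K}"
        "saturation T M'' (g ` N) = saturation T M'' (g ` K)" by auto
      have "x \<in> N" if x: "x \<in> K" for x
      proof -
        have xM: "x \<in> carrier M" using x K' f.N.submodule_carrier by blast
        have "g ` K \<subseteq> carrier M''" using f.N.submodule_carrier[OF K'] by auto
        then have "g x \<in> saturation T M'' (g ` N)"
          using x eq(2) g.N.saturation_superset[OF T, of "g ` K"] by blast
        then obtain r n where rn: "r \<in> T" "n \<in> N" "r \<odot>\<^bsub>M''\<^esub> g x = g n"
          by (auto simp: saturation_def)
        have nM: "n \<in> carrier M" using rn N' f.N.submodule_carrier by blast
        let ?d = "r \<odot>\<^bsub>M\<^esub> x \<ominus>\<^bsub>M\<^esub> n"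
        have "g ?d = \<zero>\<^bsub>M''\<^esub>" using rn xM nM TR by (simp add: g.N.minus_eq_zero_iff)
        then have "?d \<in> f ` carrier M'" using ker rn xM nM TR by simp
        then obtain m where m: "m \<in> carrier M'" "?d = f m" by blast
        have "?d \<in> K"
          using f.N.submodule_minus_closed[OF K'] f.N.submoduleE(4)[OF K'] rn x NK TR by auto
        then have "f m \<in> N" using eq(1) m by auto
        then have "?d \<oplus>\<^bsub>M\<^esub> n \<in> N" using m f.N.submoduleE(5)[OF N'] rn by simp
        also have "?d \<oplus>\<^bsub>M\<^esub> n = r \<odot>\<^bsub>M\<^esub> x"
          using xM nM rn TR by (simp add: a_minus_def f.N.a_assoc f.N.l_neg)
        finally show ?thesis using f.N.closed_submodulesD(2)[OF N] rn xM by blast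
      qed
      then show False using NK by blast
    qed
  next
    fix N assume N: "N \<in> closed_submodules R T M"
    show "{x \<in> carrier M'. f x \<in> N} \<in> closed_submodules R T M'"
      by (rule f.vimage_closed[OF submonoid.subset[OF T] N])
    show "saturation T M'' (g ` N) \<in> closed_submodules R T M''"
      using f.N.closed_submodulesD(1)[OF N] by (intro g.N.saturation_closed[OF T] g.image_submodule)
  qed
qed

text \<open>Chains of saturated images from \<open>M'\<close> can be continued by chains of
  preimages from \<open>M''\<close>: the image of \<open>f\<close> lies in the kernel of
  \<open>g\<close>, hence in every such preimage, and preimages are closed, so they contain the
  saturations too. Finiteness passes from \<open>M\<close> to both outer terms.\<close>

lemma rel_length_additive:
  assumes T: "submonoid T R" and mods: "module R M'" "module R M" "module R M''"
    and ex: "short_exact R M' f M g M''"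
    and fin: "rel_length R T M \<noteq> \<infinity>"
  shows "rel_length R T M = rel_length R T M' + rel_length R T M''"
proof (rule antisym)
  show "rel_length R T M \<le> rel_length R T M' + rel_length R T M''"
    by (rule rel_length_subadd[OF assms(1-5)])
  have f: "f \<in> module_hom R M' M" and g: "g \<in> module_hom R M M''" and inj: "inj_on f (carrier M')"
    and ker: "f ` carrier M' = {x \<in> carrier M. g x = \<zero>\<^bsub>M''\<^esub>}" and surj: "g ` carrier M = carrier M''"
    using ex by (auto simp: short_exact_def)
  interpret f: module_morphism R M' M f by (rule module_morphismI[OF mods(1,2) f])
  interpret g: module_morphism R M M'' g by (rule module_morphismI[OF mods(2,3) g])
  have TR: "T \<subseteq> carrier R" using submonoid.subset[OF T] .
  have "rel_length R T M' \<noteq> \<infinity>" by (rule enat_le_finite[OF f.rel_length_le_of_inj[OF T inj] fin])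
  moreover have "rel_length R T M'' \<noteq> \<infinity>" by (rule enat_le_finite[OF g.rel_length_le_of_surj[OF T surj] fin])
  ultimately show "rel_length R T M' + rel_length R T M'' \<le> rel_length R T M"
    unfolding rel_length_def
  proof (rule chain_length_superadd[where a = "\<lambda>N. saturation T M (f ` N)"
        and b = "\<lambda>N. {x \<in> carrier M. g x \<in> N}"])
    fix N assume N: "N \<in> closed_submodules R T M'"
    note N' = f.M.closed_submodulesD(1)[OF N]
    show "saturation T M (f ` N) \<in> closed_submodules R T M"
      using N' by (intro f.N.saturation_closed[OF T] f.image_submodule)
    fix K assume K: "K \<in> closed_submodules R T M''"
    have "f ` N \<subseteq> {x \<in> carrier M. g x \<in> K}"
    proof
      fix x assume "x \<in> f ` N"
      then have "x \<in> f ` carrier M'" using f.M.submodule_carrier[OF N'] by blast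
      then show "x \<in> {x \<in> carrier M. g x \<in> K}"
        using ker g.N.submodule_zero_closed[OF g.N.closed_submodulesD(1)[OF K]] by auto
    qed
    then show "saturation T M (f ` N) \<subseteq> {x \<in> carrier M. g x \<in> K}"
      by (rule f.N.saturation_minimal[OF g.vimage_closed[OF TR K]])
  next
    fix N assume "N \<in> closed_submodules R T M''"
    then show "{x \<in> carrier M. g x \<in> N} \<in> closed_submodules R T M"
      by (rule g.vimage_closed[OF TR])
  next
    fix N K assume "K \<in> closed_submodules R T M''" "N \<subset> K"
    then show "{x \<in> carrier M. g x \<in> N} \<subset> {x \<in> carrier M. g x \<in> K}"
      using g.N.closed_submodulesD(1) g.N.submoduleE(1) by (intro g.vimage_strict[OF surj]) auto
  next
    fix N K assume "N \<in> closed_submodules R T M'" "K \<in> closed_submodules R T M'" "N \<subset> K"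
    then show "saturation T M (f ` N) \<subset> saturation T M (f ` K)"
      by (rule f.saturation_image_strict[OF T inj])
  qed (rule f.M.closed_submodules_nonempty g.N.closed_submodules_nonempty)+
qed

section \<open>Finiteness of the rank over a domain\<close>

lemma (in domain) submonoid_nonzero: "submonoid (carrier R - {\<zero>}) R"
proof
  show "\<one> \<in> carrier R - {\<zero>}" by simp
  fix a b assume "a \<in> carrier R - {\<zero>}" "b \<in> carrier R - {\<zero>}"
  then show "a \<otimes> b \<in> carrier R - {\<zero>}" using integral by auto
qed auto

text \<open>The induction over generators bounds the chains of traces on \<open>h S\<close> of the
  closed submodules of M. All sets involved stay inside the one module M, and for a full generating
  set the traces are the closed submodules themselves.\<close>

lemma rank_finite:
  fixes M :: "('r, 'm) module"
  assumes "domain R" "module R M" "finitely_generated R M"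
  shows "rel_length R (carrier R - {\<zero>\<^bsub>R\<^esub>}) M \<noteq> \<infinity>"
proof -
  interpret R: domain R by fact
  interpret module R M by fact
  let ?T = "carrier R - {\<zero>\<^bsub>R\<^esub>}"
  define h where "h = module_hull R M"
  obtain S where S: "finite S" "S \<subseteq> carrier M" "h S = carrier M"
    using assms(3) unfolding finitely_generated_iff[OF assms(2)] h_def by blast
  define F where "F S = (\<lambda>N. N \<inter> h S) ` closed_submodules R ?T M" for S
  have "chain_length (F S) \<noteq> \<infinity>"
    using S(1,2)
  proof (induction S)
    case empty
    have "F {} \<subseteq> {{\<zero>\<^bsub>M\<^esub>}}"
      using submodule_zero_closed closed_submodulesD(1) by (auto simp: F_def h_def module_hull_empty)
    then have "finite (F {})" by (rule finite_subset) simp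
    then show ?case using enat_le_finite[OF chain_length_le_card[of "F {}"]] by simp
  next
    \<comment> \<open>Passing from \<open>h S\<close> to \<open>h (insert s S)\<close> adds at most one step, at which the closed
      submodule acquires an element with a nonzero coefficient at \<open>s\<close>.\<close>
    case (insert s S)
    then have sS: "s \<in> carrier M" "S \<subseteq> carrier M" by auto
    have hS: "submodule (h S) R M" "submodule (h (insert s S)) R M"
      using module_hull_submodule sS by (auto simp: h_def)
    have sub: "h S \<subseteq> h (insert s S)" by (auto simp: h_def module_hull_def)
    \<comment> \<open>A truth value is encoded as a subset of \<open>unit\<close>. The target then
      has two elements and chains of at most one step, and \<beta> fits the form required by
      \<open>chain_length_subadd\<close>.\<close>
    define \<beta> where "\<beta> N = (if \<exists>r\<in>?T. \<exists>y\<in>h S. r \<odot>\<^bsub>M\<^esub> s \<oplus>\<^bsub>M\<^esub> y \<in> N then UNIV else ({} :: unit set))" for N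
    have "chain_length (F (insert s S)) \<le> chain_length (F S) + chain_length (UNIV :: unit set set)"
    proof (rule chain_length_subadd[where \<alpha> = "\<lambda>N. N \<inter> h S" and \<beta> = \<beta>])
      fix U assume "U \<in> F (insert s S)"
      then obtain N where "N \<in> closed_submodules R ?T M" "U = N \<inter> h (insert s S)" by (auto simp: F_def)
      moreover from this have "U \<inter> h S = N \<inter> h S" using sub by blast
      ultimately show "U \<inter> h S \<in> F S" by (auto simp: F_def)
    next
      fix U W assume U: "U \<in> F (insert s S)" and W: "W \<in> F (insert s S)" and UW: "U \<subset> W"
      obtain N where N: "N \<in> closed_submodules R ?T M" "U = N \<inter> h (insert s S)" using U by (auto simp: F_def)
      obtain K where K: "K \<in> closed_submodules R ?T M" "W = K \<inter> h (insert s S)" using W by (auto simp: F_def)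
      have U': "submodule U R M" and W': "submodule W R M"
        using N K hS closed_submodulesD(1) submodule_Int by auto
      show "U \<inter> h S \<noteq> W \<inter> h S \<or> \<beta> U \<noteq> \<beta> W"
      proof (rule ccontr)
        assume "\<not> ?thesis"
        then have eq: "U \<inter> h S = W \<inter> h S" "\<beta> U = \<beta> W" by auto
        have "x \<in> U" if x: "x \<in> W" for x
        proof -
          have "x \<in> module_hull R M (insert s S)" using x K by (auto simp: h_def)
          then obtain c y where cy: "c \<in> carrier R" "y \<in> h S" "x = c \<odot>\<^bsub>M\<^esub> s \<oplus>\<^bsub>M\<^esub> y"
            using module_hull_insert[OF sS] h_def by metis
          have yM: "y \<in> carrier M" using submodule_carrier[OF hS(1)] cy by blast
          have xM: "x \<in> carrier M" using cy yM sS by simp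
          show ?thesis
          proof (cases "c = \<zero>\<^bsub>R\<^esub>")
            case True
            then have "x = y" using cy yM sS by simp
            then show ?thesis using eq x cy by blast
          next
            case False
            then have "\<beta> W = UNIV" using x cy by (auto simp: \<beta>_def)
            then have "\<beta> U \<noteq> {}" using eq(2) by simp
            then obtain r z where rz: "r \<in> ?T" "z \<in> h S" "r \<odot>\<^bsub>M\<^esub> s \<oplus>\<^bsub>M\<^esub> z \<in> U"
              unfolding \<beta>_def by (auto split: if_splits)
            have zM: "z \<in> carrier M" using submodule_carrier[OF hS(1)] rz by blast
            \<comment> \<open>Cross-multiplication eliminates \<open>s\<close>: \<open>?u\<close>
              and r x both have coefficient r c at \<open>s\<close>, so their difference
              \<open>?w\<close> lies in \<open>h S\<close>, where \<open>U\<close> and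
              \<open>W\<close> agree. Hence r x lies in \<open>N\<close>, and closedness of
              \<open>N\<close> cancels r.\<close>
            let ?u = "c \<odot>\<^bsub>M\<^esub> (r \<odot>\<^bsub>M\<^esub> s \<oplus>\<^bsub>M\<^esub> z)"
            let ?w = "r \<odot>\<^bsub>M\<^esub> y \<ominus>\<^bsub>M\<^esub> c \<odot>\<^bsub>M\<^esub> z"
            have u: "?u \<in> U" using submoduleE(4)[OF U'] cy rz by blast
            have w: "r \<odot>\<^bsub>M\<^esub> x = ?u \<oplus>\<^bsub>M\<^esub> ?w"
              using cy rz sS yM zM
              by (simp add: smult_r_distr smult_assoc1[symmetric] R.m_comm[of c r] a_minus_def
                  M.a_assoc M.a_lcomm[of "c \<odot>\<^bsub>M\<^esub> z"] M.r_neg)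
            have cancel: "u' \<oplus>\<^bsub>M\<^esub> w' \<ominus>\<^bsub>M\<^esub> u' = w'" if "u' \<in> carrier M" "w' \<in> carrier M" for u' w'
              using that by (simp add: a_minus_def M.a_comm[of u' w'] M.a_assoc M.r_neg)
            have "r \<odot>\<^bsub>M\<^esub> x \<ominus>\<^bsub>M\<^esub> ?u = ?w"
              unfolding w using cy rz sS yM zM by (intro cancel) auto
            moreover have "r \<odot>\<^bsub>M\<^esub> x \<in> W" using x rz by (intro submoduleE(4)[OF W']) auto
            moreover have "?u \<in> W" using u UW by blast
            ultimately have "?w \<in> W" using submodule_minus_closed[OF W'] by metis
            moreover have "?w \<in> h S"
              using cy rz by (intro submodule_minus_closed[OF hS(1)] submoduleE(4)[OF hS(1)]) auto
            ultimately have "?w \<in> U" using eq(1) by blast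
            then have "r \<odot>\<^bsub>M\<^esub> x \<in> N" using w u submoduleE(5)[OF U'] N(2) by auto
            then have "x \<in> N" using closed_submodulesD(2)[OF N(1) rz(1) xM] by simp
            then show ?thesis using x K(2) N(2) by blast
          qed
        qed
        then show False using UW by blast
      qed
      show "U \<inter> h S \<subseteq> W \<inter> h S" using UW by blast
      show "\<beta> U \<subseteq> \<beta> W" using UW by (auto simp: \<beta>_def split: if_splits)
    qed simp
    moreover have "chain_length (UNIV :: unit set set) \<noteq> \<infinity>"
      using enat_le_finite[OF chain_length_le_card[of "UNIV :: unit set set"]] by simp
    moreover have "chain_length (F S) \<noteq> \<infinity>" using insert by simp
    ultimately show ?case by (auto dest: enat_le_finite simp: plus_eq_infty_iff_enat simp del: not_infinity_eq)
  qed
  moreover have "F S = closed_submodules R ?T M"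
  proof -
    have "N \<inter> h S = N" if "N \<in> closed_submodules R ?T M" for N
      using closed_submodulesD(1)[OF that] submoduleE(1) S(3) by blast
    then show ?thesis by (auto simp: F_def)
  qed
  ultimately show ?thesis by (simp add: rel_length_def)
qed

section \<open>Grothendieck groups\<close>

lemma iso_class_cong:
  assumes "module R M" "module R N" "module_iso R M N"
  shows "iso_class R M = iso_class R N"
  unfolding iso_class_def
  using module_iso_trans[OF assms(3)] module_iso_trans[OF module_iso_sym[OF assms]] by blast

lemma iso_class_self: "module R M \<Longrightarrow> M \<in> iso_class R M"
  by (simp add: iso_class_def module_iso_refl)

lemma K0_free_simps [simp]:
  "x \<in> carrier (K0_free R C) \<longleftrightarrow> Poly_Mapping.keys x \<subseteq> iso_class R ` C"
  "\<one>\<^bsub>K0_free R C\<^esub> = 0" "x \<otimes>\<^bsub>K0_free R C\<^esub> y = x + y"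
  by (simp_all add: K0_free_def)

lemma comm_group_K0_free: "comm_group (K0_free R C)"
  unfolding K0_free_def by (rule abelian_free_Abelian_group)

lemma K0_generators_closed:
  assumes "M' \<in> C" "M \<in> C" "M'' \<in> C"
  shows "Poly_Mapping.keys (frag_of (iso_class R M) - (frag_of (iso_class R M') + frag_of (iso_class R M'')))
    \<subseteq> iso_class R ` C"
  using assms
  by (auto dest!: subsetD [OF keys_diff] subsetD [OF keys_add] split: if_splits)

lemma subgroup_K0_relations: "subgroup (K0_relations R C) (K0_free R C)"
proof -
  interpret F: comm_group "K0_free R C" by (rule comm_group_K0_free)
  show ?thesis
    unfolding K0_relations_def
    by (rule F.generate_is_subgroup) (auto dest: subsetD[OF K0_generators_closed])
qed

lemma K0_relations_leI:
  assumes "subgroup H (K0_free R C)"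
    and "\<And>M' M M'' f g. M' \<in> C \<Longrightarrow> M \<in> C \<Longrightarrow> M'' \<in> C \<Longrightarrow> short_exact R M' f M g M'' \<Longrightarrow>
      frag_of (iso_class R M) - (frag_of (iso_class R M') + frag_of (iso_class R M'')) \<in> H"
  shows "K0_relations R C \<subseteq> H"
proof -
  interpret F: comm_group "K0_free R C" by (rule comm_group_K0_free)
  show ?thesis
    unfolding K0_relations_def using assms by (intro F.generate_subgroup_incl) auto
qed

lemma K0_relation_of_exact:
  assumes "M' \<in> C" "M \<in> C" "M'' \<in> C" "short_exact R M' f M g M''"
  shows "frag_of (iso_class R M) - (frag_of (iso_class R M') + frag_of (iso_class R M'')) \<in> K0_relations R C"
  unfolding K0_relations_def using assms by (intro generate.incl CollectI exI conjI) (rule refl)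

text \<open>The two free groups share addition and negation and differ only in their carriers. The
  relations for \<open>B\<close> that are supported on classes from \<open>A\<close> thus form a
  subgroup of the free group for \<open>A\<close>, and it contains the generating relations for
  \<open>A\<close>.\<close>

lemma K0_relations_mono:
  assumes "A \<subseteq> B" shows "K0_relations R A \<subseteq> K0_relations R B"
proof -
  interpret FA: comm_group "K0_free R A" by (rule comm_group_K0_free)
  interpret FB: comm_group "K0_free R B" by (rule comm_group_K0_free)
  interpret S: subgroup "K0_relations R B" "K0_free R B" by (rule subgroup_K0_relations)
  have "K0_relations R A \<subseteq> K0_relations R B \<inter> carrier (K0_free R A)"
  proof (rule K0_relations_leI)
    show "subgroup (K0_relations R B \<inter> carrier (K0_free R A)) (K0_free R A)"
    proof (rule FA.subgroupI)
      show "K0_relations R B \<inter> carrier (K0_free R A) \<noteq> {}" using S.one_closed by auto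
    next
      fix x assume x: "x \<in> K0_relations R B \<inter> carrier (K0_free R A)"
      then have "inv\<^bsub>K0_free R B\<^esub> x = - x" "inv\<^bsub>K0_free R A\<^esub> x = - x"
        using S.mem_carrier[of x] by (simp_all add: K0_free_def)
      then show "inv\<^bsub>K0_free R A\<^esub> x \<in> K0_relations R B \<inter> carrier (K0_free R A)"
        using x S.m_inv_closed[of x] FA.inv_closed[of x] by auto
    next
      fix x y assume xy: "x \<in> K0_relations R B \<inter> carrier (K0_free R A)" "y \<in> K0_relations R B \<inter> carrier (K0_free R A)"
      then show "x \<otimes>\<^bsub>K0_free R A\<^esub> y \<in> K0_relations R B \<inter> carrier (K0_free R A)"
        using S.m_closed[of x y] FA.m_closed[of x y] by auto
    qed simp
  next
    fix M' M M'' f g assume *: "M' \<in> A" "M \<in> A" "M'' \<in> A" and ex: "short_exact R M' f M g M''"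
    from * assms have "M' \<in> B" "M \<in> B" "M'' \<in> B" by auto
    from K0_relation_of_exact[OF this ex] K0_generators_closed[OF *]
    show "frag_of (iso_class R M) - (frag_of (iso_class R M') + frag_of (iso_class R M''))
      \<in> K0_relations R B \<inter> carrier (K0_free R A)" by simp
  qed
  then show ?thesis by blast
qed

lemma K0_class_eq_one_iff:
  assumes "M \<in> C"
  shows "K0_class R C M = \<one>\<^bsub>K0 R C\<^esub> \<longleftrightarrow> frag_of (iso_class R M) \<in> K0_relations R C"
proof -
  interpret F: comm_group "K0_free R C" by (rule comm_group_K0_free)
  have c: "frag_of (iso_class R M) \<in> carrier (K0_free R C)" using assms by simp
  show ?thesis
    unfolding K0_class_def K0_def one_FactGroup
    using F.coset_join1[OF _ c subgroup_K0_relations] F.coset_join2[OF c subgroup_K0_relations] by blast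
qed

lemma K0_class_closed: "M \<in> C \<Longrightarrow> K0_class R C M \<in> carrier (K0 R C)"
  unfolding K0_class_def K0_def carrier_FactGroup by (rule imageI) simp

text \<open>This is the universal property of K_0, evaluated at a trivial class: \<phi> extends to
  the free group, and the extension kills all relations by additivity.\<close>

lemma additive_invariant_eq_0:
  fixes \<phi> :: "('r, 'm) module \<Rightarrow> int"
  assumes mods: "\<And>M. M \<in> C \<Longrightarrow> module R M"
    and iso: "\<And>M N. M \<in> C \<Longrightarrow> N \<in> C \<Longrightarrow> module_iso R M N \<Longrightarrow> \<phi> M = \<phi> N"
    and add: "\<And>M' M M'' f g. M' \<in> C \<Longrightarrow> M \<in> C \<Longrightarrow> M'' \<in> C \<Longrightarrow> short_exact R M' f M g M'' \<Longrightarrow>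
      \<phi> M = \<phi> M' + \<phi> M''"
    and M: "M \<in> C" "K0_class R C M = \<one>\<^bsub>K0 R C\<^esub>"
  shows "\<phi> M = 0"
proof -
  interpret Z: comm_group integer_group by (rule abelian_integer_group)
  \<comment> \<open>An isomorphism class may contain modules outside \<open>C\<close>, where nothing
    is assumed about \<phi>; the representative is therefore chosen in \<open>C\<close>.\<close>
  define \<psi> where "\<psi> c = \<phi> (SOME N. N \<in> C \<and> N \<in> c)" for c
  have \<psi>: "\<psi> (iso_class R M) = \<phi> M" if "M \<in> C" for M
  proof -
    let ?N = "SOME N. N \<in> C \<and> N \<in> iso_class R M"
    have "?N \<in> C \<and> ?N \<in> iso_class R M"
      by (rule someI[of _ M]) (use that mods iso_class_self in auto)
    then have "\<phi> M = \<phi> ?N" using that by (intro iso) (auto simp: iso_class_def)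
    then show ?thesis by (simp add: \<psi>_def)
  qed
  obtain h where h: "h \<in> hom (free_Abelian_group (iso_class R ` C)) integer_group"
    "\<And>x. x \<in> iso_class R ` C \<Longrightarrow> h (frag_of x) = \<psi> x"
    using Z.free_Abelian_group_universal[of \<psi> "iso_class R ` C"] by auto
  have hom: "h \<in> hom (K0_free R C) integer_group" using h(1) by (simp add: K0_free_def)
  interpret F: comm_group "K0_free R C" by (rule comm_group_K0_free)
  interpret H: group_hom "K0_free R C" integer_group h
    by unfold_locales (rule hom)
  have hadd: "h (x + y) = h x + h y" if "x \<in> carrier (K0_free R C)" "y \<in> carrier (K0_free R C)" for x y
    using H.hom_mult[OF that] by simp
  have hfrag: "h (frag_of (iso_class R M)) = \<phi> M" if "M \<in> C" for M
    using h(2) \<psi> that by simp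
  have "K0_relations R C \<subseteq> kernel (K0_free R C) integer_group h"
  proof (rule K0_relations_leI[OF H.subgroup_kernel])
    fix M' M M'' f g assume *: "M' \<in> C" "M \<in> C" "M'' \<in> C" and ex: "short_exact R M' f M g M''"
    let ?s = "frag_of (iso_class R M') + frag_of (iso_class R M'')"
    have c: "frag_of (iso_class R M) - ?s \<in> carrier (K0_free R C)"
      using K0_generators_closed[OF *] by simp
    have s: "?s \<in> carrier (K0_free R C)"
      using F.m_closed[of "frag_of (iso_class R M')" "frag_of (iso_class R M'')"] * by simp
    \<comment> \<open>The value at a difference is found by adding \<open>?s\<close> back, since
      \<open>hadd\<close> speaks of sums.\<close>
    have "h (frag_of (iso_class R M) - ?s) + h ?s = h (frag_of (iso_class R M))"
      using hadd[OF c s] by simp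
    moreover have "h ?s = \<phi> M' + \<phi> M''" using * by (subst hadd) (auto simp: hfrag)
    ultimately have "h (frag_of (iso_class R M) - ?s) = 0" using * add[OF * ex] by (simp add: hfrag)
    then show "frag_of (iso_class R M) - ?s \<in> kernel (K0_free R C) integer_group h"
      using c by (simp add: kernel_def)
  qed
  moreover have "frag_of (iso_class R M) \<in> K0_relations R C"
    using M K0_class_eq_one_iff by blast
  ultimately show ?thesis using M(1) by (auto simp: kernel_def hfrag)
qed

section \<open>The homomorphism of Grothendieck groups induced by an inclusion\<close>

context
  fixes A B :: "('r, 'm) module set" and R :: "('r, 'x) ring_scheme"
  assumes AB: "A \<subseteq> B"
begin

text \<open>Adding the relations for \<open>B\<close> absorbs those for \<open>A\<close>, which are
  among them; no element is lost because 0 is a relation for \<open>A\<close>.\<close>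

lemma K0_incl_coset:
  assumes x: "x \<in> carrier (K0_free R A)"
  shows "K0_incl R B (K0_relations R A #>\<^bsub>K0_free R A\<^esub> x) = K0_relations R B #>\<^bsub>K0_free R B\<^esub> x"
proof -
  interpret SA: subgroup "K0_relations R A" "K0_free R A" by (rule subgroup_K0_relations)
  interpret SB: subgroup "K0_relations R B" "K0_free R B" by (rule subgroup_K0_relations)
  have "b + (a + x) \<in> (\<lambda>h. h + x) ` K0_relations R B"
    if "b \<in> K0_relations R B" "a \<in> K0_relations R A" for a b
    using that K0_relations_mono[OF AB] SB.m_closed[of b a]
    by (intro image_eqI[of _ _ "b + a"]) (auto simp: add.assoc)
  moreover have "\<exists>a\<in>K0_relations R A. b + x = b + (a + x)" for b
    using SA.one_closed by (intro bexI[of _ 0]) auto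
  ultimately show ?thesis
    unfolding K0_incl_def r_coset_def set_mult_def by (fastforce simp: image_iff)
qed

lemma K0_incl_class: "M \<in> A \<Longrightarrow> K0_incl R B (K0_class R A M) = K0_class R B M"
  unfolding K0_class_def by (rule K0_incl_coset) simp

lemma K0_incl_hom: "K0_incl R B \<in> hom (K0 R A) (K0 R B)"
proof -
  interpret FA: comm_group "K0_free R A" by (rule comm_group_K0_free)
  interpret FB: comm_group "K0_free R B" by (rule comm_group_K0_free)
  interpret SA: normal "K0_relations R A" "K0_free R A"
    by (rule FA.subgroup_imp_normal[OF subgroup_K0_relations])
  interpret SB: normal "K0_relations R B" "K0_free R B"
    by (rule FB.subgroup_imp_normal[OF subgroup_K0_relations])
  have sub: "carrier (K0_free R A) \<subseteq> carrier (K0_free R B)"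
  proof
    fix x assume "x \<in> carrier (K0_free R A)"
    then have "Poly_Mapping.keys x \<subseteq> iso_class R ` A" by simp
    also have "\<dots> \<subseteq> iso_class R ` B" using AB by (rule image_mono)
    finally show "x \<in> carrier (K0_free R B)" by simp
  qed
  show ?thesis
  proof (rule homI)
    fix \<xi> assume "\<xi> \<in> carrier (K0 R A)"
    then obtain x where x: "x \<in> carrier (K0_free R A)" "\<xi> = K0_relations R A #>\<^bsub>K0_free R A\<^esub> x"
      unfolding K0_def carrier_FactGroup by blast
    then have "x \<in> carrier (K0_free R B)" using sub by blast
    then show "K0_incl R B \<xi> \<in> carrier (K0 R B)"
      unfolding x(2) K0_incl_coset[OF x(1)] K0_def carrier_FactGroup by (rule imageI)
  next
    fix \<xi> \<eta> assume "\<xi> \<in> carrier (K0 R A)" "\<eta> \<in> carrier (K0 R A)"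
    then obtain x y where x: "x \<in> carrier (K0_free R A)" "\<xi> = K0_relations R A #>\<^bsub>K0_free R A\<^esub> x"
      and y: "y \<in> carrier (K0_free R A)" "\<eta> = K0_relations R A #>\<^bsub>K0_free R A\<^esub> y"
      unfolding K0_def carrier_FactGroup by blast
    have xy: "x + y \<in> carrier (K0_free R A)" using FA.m_closed[OF x(1) y(1)] by simp
    have "\<xi> \<otimes>\<^bsub>K0 R A\<^esub> \<eta> = K0_relations R A #>\<^bsub>K0_free R A\<^esub> (x + y)"
      using SA.rcos_sum[OF x(1) y(1)] by (simp add: K0_def x(2) y(2))
    then have "K0_incl R B (\<xi> \<otimes>\<^bsub>K0 R A\<^esub> \<eta>) = K0_relations R B #>\<^bsub>K0_free R B\<^esub> (x + y)"
      by (simp only: K0_incl_coset[OF xy])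
    also have "\<dots> = K0_incl R B \<xi> \<otimes>\<^bsub>K0 R B\<^esub> K0_incl R B \<eta>"
      unfolding x(2) y(2) K0_incl_coset[OF x(1)] K0_incl_coset[OF y(1)]
      using SB.rcos_sum[OF subsetD[OF sub x(1)] subsetD[OF sub y(1)]] by (simp add: K0_def)
    finally show "K0_incl R B (\<xi> \<otimes>\<^bsub>K0 R A\<^esub> \<eta>) = K0_incl R B \<xi> \<otimes>\<^bsub>K0 R B\<^esub> K0_incl R B \<eta>" .
  qed
qed

end

section \<open>Regular and quotient modules\<close>

definition regular_module :: "('r, 'x) ring_scheme \<Rightarrow> ('r, 'r) module" where
  "regular_module R = \<lparr>carrier = carrier R, monoid.mult = monoid.mult R, one = \<one>\<^bsub>R\<^esub>,
     ring.zero = \<zero>\<^bsub>R\<^esub>, add = add R, module.smult = monoid.mult R\<rparr>"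

lemma regular_module_simps [simp]:
  "carrier (regular_module R) = carrier R" "\<zero>\<^bsub>regular_module R\<^esub> = \<zero>\<^bsub>R\<^esub>"
  "x \<oplus>\<^bsub>regular_module R\<^esub> y = x \<oplus>\<^bsub>R\<^esub> y" "r \<odot>\<^bsub>regular_module R\<^esub> x = r \<otimes>\<^bsub>R\<^esub> x"
  by (simp_all add: regular_module_def)

lemma (in cring) regular_module: "module R (regular_module R)"
proof (rule moduleI)
  show "abelian_group (regular_module R)"
  proof (rule abelian_groupI)
    fix x assume "x \<in> carrier (regular_module R)"
    then show "\<exists>y\<in>carrier (regular_module R). y \<oplus>\<^bsub>regular_module R\<^esub> x = \<zero>\<^bsub>regular_module R\<^esub>"
      by (intro bexI[of _ "\<ominus> x"]) (auto simp: l_neg)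
  qed (auto simp: a_ac)
qed (auto simp: is_cring l_distr r_distr m_assoc)

lemma (in cring) regular_module_finitely_generated: "finitely_generated R (regular_module R)"
proof (rule cyclic_finitely_generated[OF regular_module])
  show "carrier (regular_module R) = (\<lambda>r. r \<odot>\<^bsub>regular_module R\<^esub> \<one>) ` carrier R"
    by (auto intro: image_eqI[of _ "\<lambda>r. r \<otimes> \<one>"])
qed simp

text \<open>The localization is the fraction field, of dimension 1. Concretely, if a closed
  submodule contains x different from 0, then x = x 1 lies in it and closedness with multiplier x
  puts 1 into it.\<close>

lemma (in domain) rel_length_regular_module:
  "rel_length R (carrier R - {\<zero>}) (regular_module R) = 1"
proof -
  interpret P: module R "regular_module R" by (rule regular_module)
  let ?T = "carrier R - {\<zero>}"
  have "N = {\<zero>} \<or> N = carrier R" if N: "N \<in> closed_submodules R ?T (regular_module R)" for N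
  proof (rule disjCI)
    assume ne: "N \<noteq> carrier R"
    note N' = P.closed_submodulesD(1)[OF N]
    have zero: "\<zero> \<in> N" using P.submodule_zero_closed[OF N'] by simp
    have sub: "N \<subseteq> carrier R" using P.submoduleE(1)[OF N'] by simp
    have "x = \<zero>" if x: "x \<in> N" for x
    proof (rule ccontr)
      assume "x \<noteq> \<zero>"
      then have "\<one> \<in> N" using x sub P.closed_submodulesD(2)[OF N, of x \<one>] by auto
      then have "carrier R \<subseteq> N" using P.submoduleE(4)[OF N', of _ \<one>] by auto
      then show False using ne sub by blast
    qed
    then show "N = {\<zero>}" using zero by blast
  qed
  moreover have "{\<zero>} \<in> closed_submodules R ?T (regular_module R)"
    using P.zero_submodule by (auto simp: closed_submodules_def dest: integral)
  moreover have "carrier R \<in> closed_submodules R ?T (regular_module R)"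
    using P.carrier_is_submodule by (auto simp: closed_submodules_def)
  ultimately have "closed_submodules R ?T (regular_module R) = {{\<zero>}, carrier R}" by blast
  moreover have "{\<zero>} \<subset> carrier R" using one_not_zero one_closed by (metis empty_subsetI insert_subset psubsetI singletonD zero_closed)
  ultimately show ?thesis unfolding rel_length_def by (simp add: chain_length_two)
qed

lemma quotient_module_simps [simp]:
  "carrier (quotient_module R I) = carrier (R Quot I)" "\<zero>\<^bsub>quotient_module R I\<^esub> = I"
  "u \<oplus>\<^bsub>quotient_module R I\<^esub> v = u \<oplus>\<^bsub>R Quot I\<^esub> v"
  "r \<odot>\<^bsub>quotient_module R I\<^esub> u = (I +>\<^bsub>R\<^esub> r) \<otimes>\<^bsub>R Quot I\<^esub> u"
  by (simp_all add: quotient_module_def FactRing_def)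

context ideal
begin

lemma rcos_simps:
  assumes "x \<in> carrier R" "y \<in> carrier R"
  shows "(I +> x) \<in> carrier (R Quot I)" "I +> (x \<oplus> y) = (I +> x) \<oplus>\<^bsub>R Quot I\<^esub> (I +> y)"
    "I +> (x \<otimes> y) = (I +> x) \<otimes>\<^bsub>R Quot I\<^esub> (I +> y)"
  using assms ring_hom_closed[OF rcos_ring_hom] ring_hom_add[OF rcos_ring_hom] ring_hom_mult[OF rcos_ring_hom]
  by auto

lemma quotient_module:
  assumes "cring R" shows "module R (quotient_module R I)"
proof -
  interpret Q: cring "R Quot I" by (rule quotient_is_cring[OF assms])
  have "abelian_group (quotient_module R I)"
  proof (rule abelian_groupI)
    fix u assume u: "u \<in> carrier (quotient_module R I)"
    then show "\<exists>v\<in>carrier (quotient_module R I). v \<oplus>\<^bsub>quotient_module R I\<^esub> u = \<zero>\<^bsub>quotient_module R I\<^esub>"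
      using Q.l_neg[of u] Q.a_inv_closed[of u]
      by (intro bexI[of _ "\<ominus>\<^bsub>R Quot I\<^esub> u"]) (auto simp: FactRing_def)
  next
    show "\<zero>\<^bsub>quotient_module R I\<^esub> \<in> carrier (quotient_module R I)"
      using Q.zero_closed by (simp add: FactRing_def)
    fix u assume "u \<in> carrier (quotient_module R I)"
    then show "\<zero>\<^bsub>quotient_module R I\<^esub> \<oplus>\<^bsub>quotient_module R I\<^esub> u = u"
      using Q.l_zero[of u] by (simp add: FactRing_def)
  qed (simp_all add: Q.a_ac)
  then show ?thesis
  proof (rule moduleI[OF assms])
    fix u assume u: "u \<in> carrier (quotient_module R I)"
    then show "\<one> \<odot>\<^bsub>quotient_module R I\<^esub> u = u"
      using Q.l_one[of u] by (simp add: FactRing_def)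
    fix a assume a: "a \<in> carrier R"
    then show "a \<odot>\<^bsub>quotient_module R I\<^esub> u \<in> carrier (quotient_module R I)"
      using u by (simp add: rcos_simps)
    fix b assume b: "b \<in> carrier R"
    show "(a \<oplus> b) \<odot>\<^bsub>quotient_module R I\<^esub> u =
      a \<odot>\<^bsub>quotient_module R I\<^esub> u \<oplus>\<^bsub>quotient_module R I\<^esub> b \<odot>\<^bsub>quotient_module R I\<^esub> u"
      "(a \<otimes> b) \<odot>\<^bsub>quotient_module R I\<^esub> u = a \<odot>\<^bsub>quotient_module R I\<^esub> (b \<odot>\<^bsub>quotient_module R I\<^esub> u)"
      using a b u by (simp_all add: rcos_simps Q.l_distr Q.m_assoc)
  next
    fix a u v assume "a \<in> carrier R" "u \<in> carrier (quotient_module R I)" "v \<in> carrier (quotient_module R I)"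
    then show "a \<odot>\<^bsub>quotient_module R I\<^esub> (u \<oplus>\<^bsub>quotient_module R I\<^esub> v) =
      a \<odot>\<^bsub>quotient_module R I\<^esub> u \<oplus>\<^bsub>quotient_module R I\<^esub> a \<odot>\<^bsub>quotient_module R I\<^esub> v"
      by (simp add: rcos_simps Q.r_distr)
  qed
qed

lemma quotient_module_hom: "(+>) I \<in> module_hom R (regular_module R) (quotient_module R I)"
  by (auto simp: module_hom_def rcos_simps)

lemma quotient_module_surj: "(+>) I ` carrier R = carrier (quotient_module R I)"
  by (auto simp: FactRing_def A_RCOSETS_def')

lemma quotient_module_kernel: "x \<in> carrier R \<Longrightarrow> I +> x = \<zero>\<^bsub>quotient_module R I\<^esub> \<longleftrightarrow> x \<in> I"
  using rcos_const_imp_mem a_rcos_const by auto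

end

section \<open>The ring of formal power series and its ideal (t)\<close>

lemma fps_ring_simps [simp]:
  "carrier fps_ring = UNIV" "\<zero>\<^bsub>fps_ring\<^esub> = 0" "\<one>\<^bsub>fps_ring\<^esub> = 1"
  "x \<oplus>\<^bsub>fps_ring\<^esub> y = x + y" "x \<otimes>\<^bsub>fps_ring\<^esub> y = x * y"
  by (simp_all add: ring_of_type_algebra_def)

lemma domain_fps_ring: "domain (fps_ring :: 'a::field fps ring)"
  by (intro domain.intro domain_axioms.intro cring_from_type_algebra) auto

lemma mem_PIdl_fps_X: "(r :: 'a::field fps) \<in> PIdl\<^bsub>fps_ring\<^esub> fps_X \<longleftrightarrow> fps_nth r 0 = 0"
proof
  assume "r \<in> PIdl\<^bsub>fps_ring\<^esub> fps_X"
  then show "fps_nth r 0 = 0" by (auto simp: cgenideal_def)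
next
  assume "fps_nth r 0 = 0"
  then have "r = fps_shift 1 r * fps_X" by (intro fps_ext) auto
  then show "r \<in> PIdl\<^bsub>fps_ring\<^esub> fps_X" unfolding cgenideal_def by auto
qed

section \<open>Modules over a power series ring\<close>

lemma finite_length_modules_iff:
  "M \<in> finite_length_modules R \<longleftrightarrow> module R M \<and> rel_length R {\<one>\<^bsub>R\<^esub>} M \<noteq> \<infinity>"
  by (cases "module R M") (simp_all add: finite_length_modules_def rel_length_one)

lemma finite_length_subset_fg: "finite_length_modules R \<subseteq> fg_modules R"
  using finitely_generated_of_finite_length by (auto simp: finite_length_modules_def fg_modules_def)

lemma (in cring) submonoid_one: "submonoid {\<one>} R"
  by unfold_locales auto

text \<open>Subobjects and quotients are covered by monotonicity of the length under injections and
  surjections, extensions by its subadditivity.\<close>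

lemma serre_subcategory_finite_length:
  assumes "cring R" and nonempty: "(finite_length_modules R :: ('r, 'm) module set) \<noteq> {}"
  shows "serre_subcategory R (finite_length_modules R :: ('r, 'm) module set) (fg_modules R)"
  unfolding serre_subcategory_def
proof (intro conjI ballI allI impI nonempty finite_length_subset_fg)
  note T = cring.submonoid_one[OF assms(1)]
  fix M N :: "('r, 'm) module" and f
  assume M: "M \<in> finite_length_modules R" and N: "N \<in> fg_modules R"
  have mods: "module R M" "module R N" using M N by (auto simp: finite_length_modules_def fg_modules_def)
  have fin: "rel_length R {\<one>\<^bsub>R\<^esub>} M \<noteq> \<infinity>" using M finite_length_modules_iff by blast
  {
    assume f: "f \<in> module_hom R N M" "inj_on f (carrier N)"
    interpret module_morphism R N M f by (rule module_morphismI[OF mods(2,1) f(1)])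
    show "N \<in> finite_length_modules R"
      using enat_le_finite[OF rel_length_le_of_inj[OF T f(2)] fin] mods finite_length_modules_iff by blast
  next
    assume f: "f \<in> module_hom R M N" "f ` carrier M = carrier N"
    interpret module_morphism R M N f by (rule module_morphismI[OF mods f(1)])
    show "N \<in> finite_length_modules R"
      using enat_le_finite[OF rel_length_le_of_surj[OF T f(2)] fin] mods finite_length_modules_iff by blast
  }
next
  note T = cring.submonoid_one[OF assms(1)]
  fix M' M M'' :: "('r, 'm) module" and f g
  assume *: "M' \<in> finite_length_modules R" "M \<in> fg_modules R" "M'' \<in> finite_length_modules R"
    and ex: "short_exact R M' f M g M''"
  have mods: "module R M'" "module R M" "module R M''"
    using * by (auto simp: finite_length_modules_def fg_modules_def)
  have "rel_length R {\<one>\<^bsub>R\<^esub>} M' + rel_length R {\<one>\<^bsub>R\<^esub>} M'' \<noteq> \<infinity>"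
    using * finite_length_modules_iff by (auto simp: plus_eq_infty_iff_enat simp del: not_infinity_eq)
  then show "M \<in> finite_length_modules R"
    using enat_le_finite[OF rel_length_subadd[OF T mods ex]] mods finite_length_modules_iff by blast
qed

text \<open>The contrapositive is what gets applied: positive length or rank forces a nonzero class.
  As the values on \<open>C\<close> are finite, \<open>the_enat\<close> turns additivity in
  \<open>enat\<close> into additivity of integers.\<close>

lemma rel_length_invariant_eq_0:
  assumes T: "submonoid T R" and mods: "\<And>M. M \<in> C \<Longrightarrow> module R M"
    and fin: "\<And>M. M \<in> C \<Longrightarrow> rel_length R T M \<noteq> \<infinity>"
    and M: "M \<in> C" "K0_class R C M = \<one>\<^bsub>K0 R C\<^esub>"
  shows "rel_length R T M = 0"
proof -
  have "int (the_enat (rel_length R T M)) = 0"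
  proof (rule additive_invariant_eq_0[where \<phi> = "\<lambda>M. int (the_enat (rel_length R T M))", OF mods _ _ M])
    fix M N assume "M \<in> C" "N \<in> C" "module_iso R M N"
    then show "int (the_enat (rel_length R T M)) = int (the_enat (rel_length R T N))"
      using rel_length_iso[OF T] mods by metis
  next
    fix M' M M'' f g assume C: "M' \<in> C" "M \<in> C" "M'' \<in> C" "short_exact R M' f M g M''"
    then have "rel_length R T M = rel_length R T M' + rel_length R T M''"
      using mods fin by (intro rel_length_additive[OF T]) auto
    moreover obtain m n where "rel_length R T M' = enat m" "rel_length R T M'' = enat n"
      using fin C by (meson not_infinity_eq)
    ultimately show "int (the_enat (rel_length R T M)) =
      int (the_enat (rel_length R T M')) + int (the_enat (rel_length R T M''))" by simp
  qed
  moreover obtain n where "rel_length R T M = enat n" using fin M by (meson not_infinity_eq)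
  ultimately show ?thesis by (simp add: zero_enat_def)
qed

text \<open>This describes a copy of k with carrier in any type, together with its projection from
  R. The coset module, its copy in the universe and an arbitrary simple object are all brought into
  this form, and any two modules of this form are isomorphic.\<close>

locale residue_module = module_morphism fps_ring "regular_module fps_ring" M p
  for M :: "('a::field fps, 'm) module" and p +
  assumes surj: "p ` UNIV = carrier M"
    and ker: "p r = \<zero>\<^bsub>M\<^esub> \<longleftrightarrow> fps_nth r 0 = 0"
begin

lemma p_one: "p 1 \<in> carrier M" "p 1 \<noteq> \<zero>\<^bsub>M\<^esub>"
  using surj ker[of 1] by auto

lemma p_eq_smult: "p r = r \<odot>\<^bsub>M\<^esub> p 1"
  using f_smult[of r 1] by simp

lemma finitely_generated_residue: "finitely_generated fps_ring M"
  by (rule cyclic_finitely_generated[OF N.module_axioms p_one(1)]) (simp flip: surj p_eq_smult)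

text \<open>A nonzero element is \<open>p r\<close> for a series \<open>r\<close> with nonzero
  constant coefficient. Such a series is a unit, so the element generates all of M.\<close>

lemma submodule_cases:
  assumes H: "submodule H fps_ring M" shows "H = {\<zero>\<^bsub>M\<^esub>} \<or> H = carrier M"
proof (rule disjCI)
  assume ne: "H \<noteq> carrier M"
  have sub: "H \<subseteq> carrier M" by (rule N.submoduleE(1)[OF H])
  have "y = \<zero>\<^bsub>M\<^esub>" if y: "y \<in> H" for y
  proof (rule ccontr)
    assume "y \<noteq> \<zero>\<^bsub>M\<^esub>"
    obtain r where r: "y = p r" using y sub surj by blast
    then have "inverse r * r = 1" using \<open>y \<noteq> \<zero>\<^bsub>M\<^esub>\<close> ker by (intro inverse_mult_eq_1) auto
    then have "p 1 = inverse r \<odot>\<^bsub>M\<^esub> y" using f_smult[of "inverse r" r] r by simp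
    then have "p 1 \<in> H" using N.submoduleE(4)[OF H, of "inverse r" y] y by simp
    then have "p s \<in> H" for s using N.submoduleE(4)[OF H, of s "p 1"] p_eq_smult[of s] by simp
    then have "carrier M \<subseteq> H" unfolding surj[symmetric] by blast
    then show False using sub ne by blast
  qed
  then show "H = {\<zero>\<^bsub>M\<^esub>}" using N.submodule_zero_closed[OF H] by blast
qed

lemma rel_length_residue: "rel_length fps_ring {\<one>\<^bsub>fps_ring\<^esub>} M = 1"
proof -
  have "closed_submodules fps_ring {\<one>\<^bsub>fps_ring\<^esub>} M = {N. submodule N fps_ring M}"
    using N.smult_one by (auto simp: closed_submodules_def)
  also have "\<dots> = {{\<zero>\<^bsub>M\<^esub>}, carrier M}"
    using submodule_cases N.zero_submodule N.carrier_is_submodule by blast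
  finally have eq: "closed_submodules fps_ring {\<one>\<^bsub>fps_ring\<^esub>} M = {{\<zero>\<^bsub>M\<^esub>}, carrier M}" .
  have "{\<zero>\<^bsub>M\<^esub>} \<subset> carrier M" using p_one N.zero_closed by blast
  then show ?thesis unfolding rel_length_def eq by (rule chain_length_two)
qed

lemma simple_residue: "simple_object fps_ring (fg_modules fps_ring) M"
  unfolding simple_object_def
proof (intro conjI ballI impI)
  show "M \<in> fg_modules fps_ring"
    using N.module_axioms finitely_generated_residue by (simp add: fg_modules_def)
  show "carrier M \<noteq> {\<zero>\<^bsub>M\<^esub>}" using p_one by blast
  fix L f assume "L \<in> (fg_modules fps_ring :: ('a fps, 'm) module set)" and f: "f \<in> module_hom fps_ring L M"
  then have "module fps_ring L" by (simp add: fg_modules_def)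
  then interpret f: module_morphism fps_ring L M f using f by (intro module_morphismI N.module_axioms)
  show "f ` carrier L = {\<zero>\<^bsub>M\<^esub>} \<or> f ` carrier L = carrier M"
    by (intro submodule_cases f.image_submodule f.M.carrier_is_submodule)
qed

end

lemma residue_modules_iso:
  assumes "residue_module M p" "residue_module N q"
  shows "module_iso fps_ring M N"
proof -
  interpret p: residue_module M p by fact
  interpret q: residue_module N q by fact
  show ?thesis
    by (rule module_iso_of_same_kernel[OF p.M.module_axioms p.N.module_axioms q.N.module_axioms p.hom _ q.hom])
       (simp_all add: p.surj q.surj p.ker q.ker)
qed

lemma residue_module_transport:
  fixes M :: "('a::field fps, 'm) module" and N :: "('a fps, 'n) module"
  assumes "residue_module M p" "module fps_ring N" "module_iso fps_ring M N"
  obtains q where "residue_module N q"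
proof -
  interpret p: residue_module M p by fact
  obtain h where h: "h \<in> module_hom fps_ring M N" "bij_betw h (carrier M) (carrier N)"
    using assms(3) by (auto simp: module_iso_def)
  interpret h: module_morphism fps_ring M N h by (rule module_morphismI[OF p.N.module_axioms assms(2) h(1)])
  have inj: "inj_on h (carrier M)" and hs: "h ` carrier M = carrier N" using h(2) by (auto simp: bij_betw_def)
  have "residue_module N (\<lambda>r. h (p r))"
  proof (intro residue_module.intro residue_module_axioms.intro module_morphismI)
    show "module fps_ring (regular_module (fps_ring :: 'a fps ring))" by (rule p.M.module_axioms)
    show "(\<lambda>r. h (p r)) \<in> module_hom fps_ring (regular_module fps_ring) N"
      by (rule module_hom_comp[OF p.hom h(1)])
    show "range (\<lambda>r. h (p r)) = carrier N" by (simp add: hs p.surj flip: image_image)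
    fix r
    have "p r \<in> carrier M" using p.surj by blast
    then have "h (p r) = \<zero>\<^bsub>N\<^esub> \<longleftrightarrow> p r = \<zero>\<^bsub>M\<^esub>"
      using inj_on_eq_iff[OF inj, of "p r" "\<zero>\<^bsub>M\<^esub>"] by simp
    then show "h (p r) = \<zero>\<^bsub>N\<^esub> \<longleftrightarrow> fps_nth r 0 = 0" using p.ker by simp
  qed (rule assms(2))
  then show thesis by (rule that)
qed

lemma residue_module_quotient:
  fixes I :: "'a::field fps set"
  defines "I \<equiv> PIdl\<^bsub>fps_ring\<^esub> fps_X"
  shows "residue_module (quotient_module fps_ring I) ((+>\<^bsub>fps_ring\<^esub>) I)"
proof -
  interpret R: cring "fps_ring :: 'a fps ring" by (rule cring_from_type_algebra)
  interpret I: ideal I "fps_ring :: 'a fps ring"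
    unfolding I_def by (rule R.cgenideal_ideal) simp
  show ?thesis
  proof (intro residue_module.intro residue_module_axioms.intro module_morphismI)
    show "module fps_ring (quotient_module fps_ring I)" by (rule I.quotient_module[OF R.is_cring])
    show "I +>\<^bsub>fps_ring\<^esub> r = \<zero>\<^bsub>quotient_module fps_ring I\<^esub> \<longleftrightarrow> fps_nth r 0 = 0" for r
      using I.quotient_module_kernel[of r] mem_PIdl_fps_X[of r] unfolding I_def by simp
  qed (use I.quotient_module_surj I.quotient_module_hom R.regular_module in auto)
qed

text \<open>A simple object is generated by any nonzero element x, so r is sent to r x surjectively.
  Its kernel is (t): t kills x, and units do not.\<close>

lemma simple_is_residue_module:
  fixes S :: "('a::field fps, 'm) module"
  assumes S: "simple_object fps_ring (fg_modules fps_ring) S"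
  obtains p where "residue_module S p"
proof -
  interpret R: cring "fps_ring :: 'a fps ring" by (rule cring_from_type_algebra)
  have "module fps_ring S" using S by (simp add: simple_object_def fg_modules_def)
  then interpret S: module fps_ring S .
  have simple: "f ` carrier N = {\<zero>\<^bsub>S\<^esub>} \<or> f ` carrier N = carrier S"
    if "N \<in> fg_modules fps_ring" "f \<in> module_hom fps_ring N S" "inj_on f (carrier N)"
    for N :: "('a fps, 'm) module" and f
    using S that unfolding simple_object_def by blast
  have gen: "range (\<lambda>r. r \<odot>\<^bsub>S\<^esub> x) = carrier S" if x: "x \<in> carrier S" "x \<noteq> \<zero>\<^bsub>S\<^esub>" for x
  proof -
    let ?H = "range (\<lambda>r. r \<odot>\<^bsub>S\<^esub> x)"
    have H: "submodule ?H fps_ring S" using S.cyclic_submodule[OF x(1)] by simp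
    have xH: "x \<in> ?H" using x S.smult_one[of x] by (intro image_eqI[of _ _ 1]) auto
    \<comment> \<open>Restricting the carrier keeps its type, so the cyclic submodule is itself an
      object of the category and simplicity can be applied to its inclusion.\<close>
    have mod: "module fps_ring (S\<lparr>carrier := ?H\<rparr>)"
      by (rule submodule.submodule_is_module[OF H S.module_axioms])
    have "S\<lparr>carrier := ?H\<rparr> \<in> fg_modules fps_ring"
      using mod xH by (auto simp: fg_modules_def intro!: cyclic_finitely_generated[OF mod, of x])
    moreover have "(\<lambda>y. y) \<in> module_hom fps_ring (S\<lparr>carrier := ?H\<rparr>) S"
      using S.submodule_carrier[OF H] by (auto simp: module_hom_def)
    ultimately have "(\<lambda>y. y) ` carrier (S\<lparr>carrier := ?H\<rparr>) = {\<zero>\<^bsub>S\<^esub>} \<or> (\<lambda>y. y) ` carrier (S\<lparr>carrier := ?H\<rparr>) = carrier S"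
      by (intro simple) simp_all
    then have "?H = {\<zero>\<^bsub>S\<^esub>} \<or> ?H = carrier S" by simp
    then show ?thesis using xH x(2) by blast
  qed
  have "carrier S \<noteq> {\<zero>\<^bsub>S\<^esub>}" using S by (simp add: simple_object_def)
  then obtain x where x: "x \<in> carrier S" "x \<noteq> \<zero>\<^bsub>S\<^esub>" using S.zero_closed by blast
  have assoc: "a \<odot>\<^bsub>S\<^esub> (b \<odot>\<^bsub>S\<^esub> x) = (a * b) \<odot>\<^bsub>S\<^esub> x" for a b
    using S.smult_assoc1[of a b x] x(1) by simp
  have unit: "r \<odot>\<^bsub>S\<^esub> x \<noteq> \<zero>\<^bsub>S\<^esub>" if "fps_nth r 0 \<noteq> 0" for r
  proof
    assume "r \<odot>\<^bsub>S\<^esub> x = \<zero>\<^bsub>S\<^esub>"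
    then have "(inverse r * r) \<odot>\<^bsub>S\<^esub> x = \<zero>\<^bsub>S\<^esub>" using assoc[of "inverse r" r] by simp
    then show False using x S.smult_one[of x] inverse_mult_eq_1[OF that] by simp
  qed
  \<comment> \<open>This is the argument of Nakayama's lemma: if t x were nonzero it would generate
    x, say x = r t x. Then 1 - r t kills x, although its constant coefficient is 1 and it is a
    unit.\<close>
  have t: "fps_X \<odot>\<^bsub>S\<^esub> x = \<zero>\<^bsub>S\<^esub>"
  proof (rule ccontr)
    assume "fps_X \<odot>\<^bsub>S\<^esub> x \<noteq> \<zero>\<^bsub>S\<^esub>"
    then obtain r where r: "x = r \<odot>\<^bsub>S\<^esub> (fps_X \<odot>\<^bsub>S\<^esub> x)"
      using gen[of "fps_X \<odot>\<^bsub>S\<^esub> x"] x(1) by auto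
    have "(1 - r * fps_X) \<odot>\<^bsub>S\<^esub> x \<oplus>\<^bsub>S\<^esub> (r * fps_X) \<odot>\<^bsub>S\<^esub> x = x"
      using S.smult_l_distr[of "1 - r * fps_X" "r * fps_X" x] x(1) S.smult_one[of x] by simp
    then have "(1 - r * fps_X) \<odot>\<^bsub>S\<^esub> x \<oplus>\<^bsub>S\<^esub> x = x" using r assoc by simp
    then have "(1 - r * fps_X) \<odot>\<^bsub>S\<^esub> x = \<zero>\<^bsub>S\<^esub>"
      using x(1) S.M.add.l_cancel_one[of x "(1 - r * fps_X) \<odot>\<^bsub>S\<^esub> x"] by (simp add: S.M.a_comm)
    then show False using unit[of "1 - r * fps_X"] by simp
  qed
  have "residue_module S (\<lambda>r. r \<odot>\<^bsub>S\<^esub> x)"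
  proof (intro residue_module.intro residue_module_axioms.intro module_morphismI)
    show "(\<lambda>r. r \<odot>\<^bsub>S\<^esub> x) \<in> module_hom fps_ring (regular_module fps_ring) S"
      using x(1) assoc S.smult_l_distr by (auto simp: module_hom_def)
    fix r
    have "r \<odot>\<^bsub>S\<^esub> x = \<zero>\<^bsub>S\<^esub>" if "fps_nth r 0 = 0"
    proof -
      have "r \<in> PIdl\<^bsub>fps_ring\<^esub> fps_X" using that mem_PIdl_fps_X by blast
      then obtain q where "r = q * fps_X" by (auto simp: cgenideal_def)
      then show ?thesis using assoc[of q fps_X] t by simp
    qed
    then show "r \<odot>\<^bsub>S\<^esub> x = \<zero>\<^bsub>S\<^esub> \<longleftrightarrow> fps_nth r 0 = 0" using unit by blast
  qed (use gen[OF x] R.regular_module S.module_axioms in auto)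
  then show thesis by (rule that)
qed

text \<open>\<open>P\<close> is a copy of R, and \<open>h\<close> transports exactness to power
  series: t can be cancelled, and its multiples are the series with zero constant coefficient, the
  kernel of \<open>p\<close>.\<close>

lemma short_exact_fps_X:
  assumes P: "module fps_ring P" and h: "h \<in> module_hom fps_ring P (regular_module fps_ring)"
    "bij_betw h (carrier P) UNIV"
    and "residue_module M p"
  shows "short_exact fps_ring P (\<lambda>x. fps_X \<odot>\<^bsub>P\<^esub> x) P (\<lambda>x. p (h x)) M"
proof -
  interpret p: residue_module M p by fact
  interpret h: module_morphism fps_ring P "regular_module fps_ring" h
    by (rule module_morphismI[OF P p.M.module_axioms h(1)])
  have inj: "inj_on h (carrier P)" and surj: "h ` carrier P = UNIV" using h(2) by (auto simp: bij_betw_def)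
  have hX: "h (fps_X \<odot>\<^bsub>P\<^esub> x) = fps_X * h x" if "x \<in> carrier P" for x
    using h.f_smult[of fps_X x] that by simp
  show ?thesis
    unfolding short_exact_def
  proof (intro conjI)
    show "(\<lambda>x. fps_X \<odot>\<^bsub>P\<^esub> x) \<in> module_hom fps_ring P P"
      using h.M.smult_assoc1 by (auto simp: module_hom_def h.M.smult_r_distr mult.commute simp flip: h.M.smult_assoc1)
    show "(\<lambda>x. p (h x)) \<in> module_hom fps_ring P M" by (rule module_hom_comp[OF h(1) p.hom])
    show "inj_on (\<lambda>x. fps_X \<odot>\<^bsub>P\<^esub> x) (carrier P)"
    proof (rule inj_onI)
      fix x y assume xy: "x \<in> carrier P" "y \<in> carrier P" "fps_X \<odot>\<^bsub>P\<^esub> x = fps_X \<odot>\<^bsub>P\<^esub> y"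
      then have "fps_X * h x = fps_X * h y" using hX by metis
      then show "x = y" using inj_onD[OF inj] xy by simp
    qed
    show "(\<lambda>x. p (h x)) ` carrier P = carrier M" by (simp add: surj p.surj flip: image_image)
    show "(\<lambda>x. fps_X \<odot>\<^bsub>P\<^esub> x) ` carrier P = {x \<in> carrier P. p (h x) = \<zero>\<^bsub>M\<^esub>}"
    proof (intro subset_antisym subsetI)
      fix y assume "y \<in> (\<lambda>x. fps_X \<odot>\<^bsub>P\<^esub> x) ` carrier P"
      then obtain x where x: "x \<in> carrier P" "y = fps_X \<odot>\<^bsub>P\<^esub> x" by blast
      then have "p (h y) = \<zero>\<^bsub>M\<^esub>" using p.ker[of "fps_X * h x"] hX[OF x(1)] by simp
      then show "y \<in> {x \<in> carrier P. p (h x) = \<zero>\<^bsub>M\<^esub>}" using x by simp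
    next
      fix y assume y: "y \<in> {x \<in> carrier P. p (h x) = \<zero>\<^bsub>M\<^esub>}"
      then have "fps_nth (h y) 0 = 0" using p.ker by simp
      then have "h y \<in> PIdl\<^bsub>fps_ring\<^esub> fps_X" unfolding mem_PIdl_fps_X .
      then obtain q where q: "h y = fps_X * q" by (auto simp: cgenideal_def mult.commute)
      obtain x where x: "x \<in> carrier P" "q = h x" using surj by blast
      then have "h y = h (fps_X \<odot>\<^bsub>P\<^esub> x)" using q hX by simp
      then have "y = fps_X \<odot>\<^bsub>P\<^esub> x" using inj_onD[OF inj] x y by simp
      then show "y \<in> (\<lambda>x. fps_X \<odot>\<^bsub>P\<^esub> x) ` carrier P" using x by blast
    qed
  qed
qed

text \<open>The injection \<open>emb\<close> provides copies of k and of R among the modules with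
  carrier in \<open>'m\<close>.\<close>

theorem proposition3p1:
  fixes emb :: "'a::field fps \<Rightarrow> 'm"
  assumes "inj emb"
  shows
    "let R = (fps_ring :: 'a fps ring);
         B = (fg_modules R :: ('a fps, 'm) module set);
         A = (finite_length_modules R :: ('a fps, 'm) module set);
         k = quotient_module R (PIdl\<^bsub>R\<^esub> fps_X)
     in (\<exists>S. simple_object R B S \<and> module_iso R S k) \<and>
        (\<forall>S. simple_object R B S \<longrightarrow> module_iso R S k) \<and>
        generate (K0 R B) {K0_class R B k} \<noteq> carrier (K0 R B) \<and>
        serre_subcategory R A B \<and>
        K0_incl R B \<in> hom (K0 R A) (K0 R B) \<and>
        (\<forall>M\<in>A. K0_incl R B (K0_class R A M) = K0_class R B M) \<and>
        \<not> inj_on (K0_incl R B) (carrier (K0 R A))"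
proof -
  define R where "R = (fps_ring :: 'a fps ring)"
  define B where "B = (fg_modules R :: ('a fps, 'm) module set)"
  define A where "A = (finite_length_modules R :: ('a fps, 'm) module set)"
  define k where "k = quotient_module R (PIdl\<^bsub>R\<^esub> fps_X)"
  define Rm where "Rm = (regular_module R :: ('a fps, 'a fps) module)"
  interpret R: domain R unfolding R_def by (rule domain_fps_ring)
  note T1 = R.submonoid_one and T = R.submonoid_nonzero
  have modB: "module R M" if "M \<in> B" for M using that by (simp add: B_def fg_modules_def)
  have modA: "module R M" if "M \<in> A" for M using that by (simp add: A_def finite_length_modules_def)
  have AB: "A \<subseteq> B" unfolding A_def B_def by (rule finite_length_subset_fg)

  have k: "residue_module k ((+>\<^bsub>fps_ring\<^esub>) (PIdl\<^bsub>fps_ring\<^esub> fps_X))"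
    unfolding k_def R_def by (rule residue_module_quotient)
  interpret k: residue_module k "(+>\<^bsub>fps_ring\<^esub>) (PIdl\<^bsub>fps_ring\<^esub> fps_X)" by (rule k)
  \<comment> \<open>The elements of \<open>k\<close> are cosets, so \<open>k\<close> need not be an
    object of \<open>A\<close> or \<open>B\<close>; its copy \<open>k'\<close> is one.\<close>
  obtain k' :: "('a fps, 'm) module" where k': "module R k'" "module_iso R k k'"
    using fg_module_iso_in_universe[OF assms k.N.module_axioms k.finitely_generated_residue]
    unfolding R_def by blast
  obtain q where q: "residue_module k' q"
    using residue_module_transport[OF k] k' unfolding R_def by blast
  interpret q: residue_module k' q by (rule q)
  have k'B: "k' \<in> B" using k'(1) q.finitely_generated_residue by (simp add: B_def fg_modules_def R_def)
  have k'A: "k' \<in> A" using k'(1) q.rel_length_residue by (simp add: A_def R_def finite_length_modules_iff)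
  have class_k: "K0_class R C k = K0_class R C k'" for C :: "('a fps, 'm) module set"
    using k.N.module_axioms by (simp add: K0_class_def iso_class_cong[OF _ k'] R_def[symmetric])

  obtain P :: "('a fps, 'm) module" where P: "module R P" "module_iso R Rm P"
    using fg_module_iso_in_universe[OF assms, of Rm] R.regular_module R.regular_module_finitely_generated
    unfolding R_def Rm_def by blast
  have Rm: "module R Rm" unfolding Rm_def by (rule R.regular_module)
  have PRm: "module_iso R P Rm" by (rule module_iso_sym[OF Rm P])
  then obtain h where h: "h \<in> module_hom R P Rm" "bij_betw h (carrier P) (carrier Rm)"
    by (auto simp: module_iso_def)
  have ex: "short_exact R P (\<lambda>x. fps_X \<odot>\<^bsub>P\<^esub> x) P (\<lambda>x. q (h x)) k'"
    using short_exact_fps_X[OF _ _ _ q] P(1) h unfolding R_def Rm_def by simp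
  interpret h: module_morphism R Rm P "inv_into (carrier P) h"
    by (intro module_morphismI Rm P(1) module_morphism.inv_into_hom[OF module_morphismI[OF P(1) Rm h(1)] h(2)])
  have "finitely_generated R P"
  proof (rule cyclic_finitely_generated[OF P(1)])
    \<comment> \<open>Every r is r times 1, so the element of \<open>P\<close> that corresponds to 1
      generates \<open>P\<close>.\<close>
    have "inv_into (carrier P) h r = r \<odot>\<^bsub>P\<^esub> inv_into (carrier P) h \<one>\<^bsub>R\<^esub>" if "r \<in> carrier R" for r
      using h.f_smult[of r "\<one>\<^bsub>R\<^esub>"] that unfolding Rm_def regular_module_simps
      by (simp only: R.one_closed R.r_one)
    note * = image_cong[OF refl this]
    have "carrier P = inv_into (carrier P) h ` carrier R"
      using bij_betw_inv_into[OF h(2)] by (simp add: bij_betw_def Rm_def)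
    also have "\<dots> = (\<lambda>r. r \<odot>\<^bsub>P\<^esub> inv_into (carrier P) h \<one>\<^bsub>R\<^esub>) ` carrier R"
      by (rule *)
    finally show "carrier P = (\<lambda>r. r \<odot>\<^bsub>P\<^esub> inv_into (carrier P) h \<one>\<^bsub>R\<^esub>) ` carrier R" .
    show "inv_into (carrier P) h \<one>\<^bsub>R\<^esub> \<in> carrier P" using h.f_closed[of "\<one>\<^bsub>R\<^esub>"] by (simp add: Rm_def)
  qed
  then have PB: "P \<in> B" using P(1) by (simp add: B_def fg_modules_def)

  have k'0: "K0_class R B k' = \<one>\<^bsub>K0 R B\<^esub>"
  proof -
    interpret S: subgroup "K0_relations R B" "K0_free R B" by (rule subgroup_K0_relations)
    \<comment> \<open>In \<open>ex\<close> the module \<open>P\<close> is both the left and the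
      middle term, so its class cancels and the relation is the negative of the generator for
      \<open>k'\<close>.\<close>
    have "- frag_of (iso_class R k') \<in> K0_relations R B"
      using K0_relation_of_exact[OF PB PB k'B ex] by simp
    from S.m_inv_closed[OF this] have "frag_of (iso_class R k') \<in> K0_relations R B"
      using k'B by (simp add: K0_free_def)
    then show ?thesis using K0_class_eq_one_iff[OF k'B] by blast
  qed
  have P1: "K0_class R B P \<noteq> \<one>\<^bsub>K0 R B\<^esub>"
  proof
    assume eq: "K0_class R B P = \<one>\<^bsub>K0 R B\<^esub>"
    have "rel_length R (carrier R - {\<zero>\<^bsub>R\<^esub>}) P = 0"
    proof (rule rel_length_invariant_eq_0[OF T _ _ PB eq])
      fix M assume "M \<in> B"
      then show "rel_length R (carrier R - {\<zero>\<^bsub>R\<^esub>}) M \<noteq> \<infinity>"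
        by (intro rank_finite[OF R.domain_axioms]) (auto simp: B_def fg_modules_def)
    qed (rule modB)
    moreover have "rel_length R (carrier R - {\<zero>\<^bsub>R\<^esub>}) P = 1"
      using rel_length_iso[OF T Rm P] R.rel_length_regular_module by (simp add: Rm_def)
    ultimately show False by simp
  qed
  have k'1: "K0_class R A k' \<noteq> \<one>\<^bsub>K0 R A\<^esub>"
  proof
    assume eq: "K0_class R A k' = \<one>\<^bsub>K0 R A\<^esub>"
    have "rel_length R {\<one>\<^bsub>R\<^esub>} k' = 0"
    proof (rule rel_length_invariant_eq_0[OF T1 _ _ k'A eq])
      show "rel_length R {\<one>\<^bsub>R\<^esub>} M \<noteq> \<infinity>" if "M \<in> A" for M
        using that unfolding A_def finite_length_modules_iff by blast
    qed (rule modA)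
    then show False using q.rel_length_residue by (simp add: R_def)
  qed
  interpret KA: comm_group "K0 R A" by (rule comm_group_K0)
  interpret KB: comm_group "K0 R B" by (rule comm_group_K0)

  have "\<exists>S. simple_object R B S \<and> module_iso R S k"
    using q.simple_residue residue_modules_iso[OF q k] unfolding R_def B_def by blast
  moreover have "\<forall>S. simple_object R B S \<longrightarrow> module_iso R S k"
    using simple_is_residue_module residue_modules_iso[OF _ k] unfolding R_def B_def by metis
  \<comment> \<open>The class of \<open>k\<close> is trivial and so generates the trivial subgroup,
    which misses the nonzero class of \<open>P\<close>.\<close>
  moreover have "generate (K0 R B) {K0_class R B k} \<noteq> carrier (K0 R B)"
    using KB.generate_one K0_class_closed[OF PB] P1 by (auto simp: class_k k'0)
  moreover have "serre_subcategory R A B"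
    using k'A unfolding A_def B_def by (intro serre_subcategory_finite_length R.is_cring) blast
  moreover have incl: "K0_incl R B \<in> hom (K0 R A) (K0 R B)" by (rule K0_incl_hom[OF AB])
  moreover have "\<forall>M\<in>A. K0_incl R B (K0_class R A M) = K0_class R B M"
    using K0_incl_class[OF AB] by blast
  moreover have "\<not> inj_on (K0_incl R B) (carrier (K0 R A))"
  proof
    assume inj: "inj_on (K0_incl R B) (carrier (K0 R A))"
    have "K0_incl R B (K0_class R A k') = K0_incl R B \<one>\<^bsub>K0 R A\<^esub>"
      using k'0 hom_one[OF incl KA.is_group KB.is_group] by (simp add: K0_incl_class[OF AB k'A])
    then show False using inj_onD[OF inj] K0_class_closed[OF k'A] k'1 by blast
  qed
  ultimately show ?thesis
    unfolding Let_def R_def[symmetric] B_def[symmetric] A_def[symmetric] k_def[symmetric] by blast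
qed

end
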